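(* Let $G$ and $H$ be Lie groups, and let $\pi\colon G\to H$ be a (not necessarily continuous) locally bounded group homomorphism. Then the discontinuity group $\operatorname{DG}(\pi)=\bigcap_{U\in\mathfrak U_G}\overline{\pi(U)}$ of $\pi$ is commutative.
   Context: Homomorphisms are group homomorphisms that are not assumed continuous. For a topological group $G$ with identity element $e_G$, $\mathfrak U_G$ denotes the filter of neighborhoods of $e_G$ in $G$. A homomorphism $\pi$ of a topological group $G$ into a locally compact group $H$ (for example, a Lie group) is called locally bounded if there is a neighborhood $U$ of $e_G$ in $G$ whose image $\pi(U)$ is contained in some neighborhood of $e_H$ in $H$ having compact closure; equivalently, $\pi(U)$ has compact closure in $H$ for some neighborhood $U$ of $e_G$. The discontinuity group of such a $\pi$ is the set $\operatorname{DG}(\pi)=\bigcap_{U\in\mathfrak U_G}\overline{\pi(U)}$, where the bar stands for closure in the topology of $H$; it is a subgroup of $H$. *)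

theory Defs
  imports "HOL-Analysis.Analysis" "HOL-Algebra.Group"
begin

(* Intended for open S: the iterated directional derivatives of f of order less than k are
   differentiable and those of order k are continuous, which is the usual notion of a k times
   continuously differentiable map. *)
primrec Ck_on :: "nat \<Rightarrow> ('a::euclidean_space \<Rightarrow> 'b::euclidean_space) \<Rightarrow> 'a set \<Rightarrow> bool" where
  "Ck_on 0 f S \<longleftrightarrow> continuous_on S f"
| "Ck_on (Suc k) f S \<longleftrightarrow>
     (\<forall>x\<in>S. f differentiable (at x)) \<and>
     (\<forall>v. Ck_on k (\<lambda>x. frechet_derivative f (at x) v) S)"

definition smooth_on :: "('a::euclidean_space \<Rightarrow> 'b::euclidean_space) \<Rightarrow> 'a set \<Rightarrow> bool" where
  "smooth_on f S \<longleftrightarrow> (\<forall>k. Ck_on k f S)"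

(* A chart is a pair of its domain and its coordinate map; the coordinate map is only relevant
   on the domain. *)
type_synonym ('p, 'e) chart = "'p set \<times> ('p \<Rightarrow> 'e)"

definition is_chart :: "'p topology \<Rightarrow> ('p, 'e::euclidean_space) chart \<Rightarrow> bool" where
  "is_chart T c \<longleftrightarrow> (case c of (U, \<phi>) \<Rightarrow>
     openin T U \<and> open (\<phi> ` U) \<and>
     homeomorphic_map (subtopology T U) (top_of_set (\<phi> ` U)) \<phi>)"

definition smooth_atlas :: "'p topology \<Rightarrow> ('p, 'e::euclidean_space) chart set \<Rightarrow> bool" where
  "smooth_atlas T A \<longleftrightarrow>
     (\<forall>c\<in>A. is_chart T c) \<and>
     (\<Union>(U, \<phi>)\<in>A. U) = topspace T \<and>
     (\<forall>(U, \<phi>)\<in>A. \<forall>(V, \<psi>)\<in>A. smooth_on (\<psi> \<circ> inv_into U \<phi>) (\<phi> ` (U \<inter> V)))"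

definition prod_atlas ::
    "('p, 'e) chart set \<Rightarrow> ('q, 'f) chart set \<Rightarrow> ('p \<times> 'q, 'e \<times> 'f) chart set" where
  "prod_atlas A B = {(U \<times> V, map_prod \<phi> \<psi>) |U \<phi> V \<psi>. (U, \<phi>) \<in> A \<and> (V, \<psi>) \<in> B}"

definition smooth_map ::
    "'p topology \<Rightarrow> ('p, 'e::euclidean_space) chart set \<Rightarrow>
     'q topology \<Rightarrow> ('q, 'f::euclidean_space) chart set \<Rightarrow> ('p \<Rightarrow> 'q) \<Rightarrow> bool" where
  "smooth_map S A T B f \<longleftrightarrow>
     continuous_map S T f \<and>
     (\<forall>(U, \<phi>)\<in>A. \<forall>(V, \<psi>)\<in>B. smooth_on (\<psi> \<circ> f \<circ> inv_into U \<phi>) (\<phi> ` (U \<inter> f -` V)))"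

(* Real Lie groups of finite dimension. The model space is given by a type, and every type of
   class euclidean_space has positive dimension; the zero-dimensional Lie groups, that is the
   discrete groups, are therefore listed separately. A Lie group may have uncountably many
   components: second countability is not required. *)
definition lie_group ::
    "'e::euclidean_space itself \<Rightarrow> ('g, 'r) monoid_scheme \<Rightarrow> 'g topology \<Rightarrow> bool" where
  "lie_group E G T \<longleftrightarrow>
     group G \<and> topspace T = carrier G \<and> Hausdorff_space T \<and>
     (T = discrete_topology (carrier G) \<or>
      (\<exists>A :: ('g, 'e) chart set.
         smooth_atlas T A \<and>
         smooth_map (prod_topology T T) (prod_atlas A A) T A (\<lambda>(x, y). x \<otimes>\<^bsub>G\<^esub> y) \<and>
         smooth_map T A T A (\<lambda>x. inv\<^bsub>G\<^esub> x)))"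

(* Neighborhoods need not be open. *)
definition nbhds :: "'p topology \<Rightarrow> 'p \<Rightarrow> 'p set set" where
  "nbhds T x = {N. N \<subseteq> topspace T \<and> (\<exists>V. openin T V \<and> x \<in> V \<and> V \<subseteq> N)}"

definition locally_bounded ::
    "('g, 'r) monoid_scheme \<Rightarrow> 'g topology \<Rightarrow> ('h, 's) monoid_scheme \<Rightarrow> 'h topology \<Rightarrow>
     ('g \<Rightarrow> 'h) \<Rightarrow> bool" where
  "locally_bounded G S H T \<pi> \<longleftrightarrow>
     (\<exists>U \<in> nbhds S \<one>\<^bsub>G\<^esub>. \<exists>V \<in> nbhds T \<one>\<^bsub>H\<^esub>. \<pi> ` U \<subseteq> V \<and> compactin T (T closure_of V))"

definition DG ::
    "('g, 'r) monoid_scheme \<Rightarrow> 'g topology \<Rightarrow> 'h topology \<Rightarrow> ('g \<Rightarrow> 'h) \<Rightarrow> 'h set" where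
  "DG G S T \<pi> = (\<Inter>U \<in> nbhds S \<one>\<^bsub>G\<^esub>. T closure_of (\<pi> ` U))"

end

(* Only the following property of the Lie group G is needed, with n = dim G. If P is a set of group
   elements near the identity to which every one-parameter curve keeps returning on all small
   scales, then all commutators [g, h] with g, h close enough to the identity are products of at most
   n commutators [p, x] with p in P. Take P = {p. pi(p) in W} for a neighborhood W of the identity of
   H; returns are forced by the pigeonhole principle since pi is bounded near the identity. As
   pi([p, x]) = w (c w^-1 c^-1) with w in W and c in a fixed compact set, pi([g, h]) is small when g
   and h are, and passing to the limit all commutators of elements of DG(pi) are trivial.

   To prove the property, let V be the span of the derivatives at the identity of y |-> [p, y] for p
   in P. Comparing with the powers of a curve t |-> sigma(t u) that lie in P one sees that V contains
   all Lie brackets. A linear map L with kernel V therefore integrates to a local homomorphism f: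
   by the Maurer-Cartan equation L composed with the Maurer-Cartan form is closed, hence exact. The
   map Psi(y) = [p_1, x_1(y)] ... [p_n, x_n(y)] sigma(L y) can be chosen with derivative the identity
   at 0, so each small [g, h] is some Psi(y); applying f gives f(sigma(L y)) = 0 and hence L y = 0. *)

theory Submission
  imports Defs
begin

section \<open>Calculus\<close>

text \<open>The order of choices shapes the argument. In \<open>H\<close>, the neighborhood that has
  to absorb a product of \<open>n\<close> commutators is fixed before \<open>W\<close>, while
  \<open>P\<close> and the number of powers among which a return is guaranteed both depend on
  \<open>W\<close>; a bound on the number of factors that depended on either would be circular. The
  dimension serves because a basis of the span can be picked from the spanning vectors themselves,
  one commutator per basis vector. The span may be a proper subspace, so commutators with entries in
  \<open>P\<close> need not fill a neighborhood of the identity. The extra factor supplies the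
  missing directions, which makes the map open at the origin; the local homomorphism then shows that
  this factor is trivial whenever the value is a commutator. It is additive only on words of bounded
  length near the identity, and its domain has to be fixed before \<open>L\<close>, because
  \<open>L\<close> depends on the part of \<open>P\<close> inside that domain. No exponential map
  enters: straight lines in a chart replace one-parameter subgroups, and two continuous derivatives
  of the group operations carry the whole calculation.\<close>

text \<open>Expanding \<open>w x\<close> in the standard basis reduces this product rule to fixed
  vectors; \<open>Ck_on\<close> speaks of directional derivatives, so the derivative of
  \<open>A q b\<close> is known for each \<open>b\<close> separately. Since \<open>A q\<close> is
  linear only for \<open>q\<close> in the open set, the expansion is replaced by
  \<open>A (c x) (w x)\<close> near \<open>x\<close>.\<close>

lemma has_derivative_linear_family:
  fixes A :: "'a::real_normed_vector \<Rightarrow> 'b::euclidean_space \<Rightarrow> 'c::real_normed_vector"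
    and c :: "'d::real_normed_vector \<Rightarrow> 'a"
  assumes S: "open S" "c x \<in> S" and lin: "\<And>q. q \<in> S \<Longrightarrow> linear (A q)"
    and lin': "\<And>u. linear (A' u)"
    and A: "\<And>b. b \<in> Basis \<Longrightarrow> ((\<lambda>q. A q b) has_derivative (\<lambda>u. A' u b)) (at (c x))"
    and c: "(c has_derivative c') (at x)" and w: "(w has_derivative w') (at x)"
  shows "((\<lambda>x. A (c x) (w x)) has_derivative (\<lambda>u. A' (c' u) (w x) + A (c x) (w' u))) (at x)"
proof -
  have exp: "F v = (\<Sum>b\<in>Basis. (v \<bullet> b) *\<^sub>R F b)" if "linear F" for F :: "'b \<Rightarrow> 'c" and v
  proof -
    have "F v = F (\<Sum>b\<in>Basis. (v \<bullet> b) *\<^sub>R b)" by (simp add: euclidean_representation)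
    also have "\<dots> = (\<Sum>b\<in>Basis. (v \<bullet> b) *\<^sub>R F b)"
      using that by (simp add: linear_sum linear_scale)
    finally show ?thesis .
  qed
  have "((\<lambda>x. \<Sum>b\<in>Basis. (w x \<bullet> b) *\<^sub>R A (c x) b) has_derivative
      (\<lambda>u. \<Sum>b\<in>Basis. (w x \<bullet> b) *\<^sub>R A' (c' u) b + (w' u \<bullet> b) *\<^sub>R A (c x) b)) (at x)"
    by (intro has_derivative_sum has_derivative_scaleR has_derivative_inner_left w
        has_derivative_compose[OF c A])
  also have "(\<lambda>u. \<Sum>b\<in>Basis. (w x \<bullet> b) *\<^sub>R A' (c' u) b + (w' u \<bullet> b) *\<^sub>R A (c x) b)
      = (\<lambda>u. A' (c' u) (w x) + A (c x) (w' u))"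
    by (simp only: sum.distrib exp[OF lin', symmetric] exp[OF lin[OF S(2)], symmetric])
  finally have D: "((\<lambda>x. \<Sum>b\<in>Basis. (w x \<bullet> b) *\<^sub>R A (c x) b) has_derivative
      (\<lambda>u. A' (c' u) (w x) + A (c x) (w' u))) (at x)" .
  have "\<exists>T. open T \<and> x \<in> T \<and> (\<forall>y\<in>T. c y \<in> S)"
    using has_derivative_continuous[OF c, unfolded continuous_at_open, rule_format, OF conjI[OF S]] .
  then obtain T where T: "open T" "x \<in> T" "\<And>y. y \<in> T \<Longrightarrow> c y \<in> S" by auto
  show ?thesis
    by (rule has_derivative_transform_within_open[OF D T(1,2)]) (rule exp[OF lin[OF T(3)], symmetric])
qed

lemma continuous_on_linear_family:
  fixes A :: "'a::topological_space \<Rightarrow> 'b::euclidean_space \<Rightarrow> 'c::real_normed_vector"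
  assumes lin: "\<And>q. q \<in> S \<Longrightarrow> linear (A q)"
    and A: "\<And>b. b \<in> Basis \<Longrightarrow> continuous_on S (\<lambda>q. A q b)"
    and w: "continuous_on S w"
  shows "continuous_on S (\<lambda>x. A x (w x))"
proof -
  have "continuous_on S (\<lambda>x. \<Sum>b\<in>Basis. (w x \<bullet> b) *\<^sub>R A x b)"
    by (intro continuous_intros A w)
  moreover have "(\<Sum>b\<in>Basis. (w x \<bullet> b) *\<^sub>R A x b) = A x (w x)" if "x \<in> S" for x
  proof -
    have "A x (w x) = A x (\<Sum>b\<in>Basis. (w x \<bullet> b) *\<^sub>R b)" by (simp add: euclidean_representation)
    also have "\<dots> = (\<Sum>b\<in>Basis. (w x \<bullet> b) *\<^sub>R A x b)"
      using lin[OF that] by (simp add: linear_sum linear_scale)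
    finally show ?thesis by simp
  qed
  ultimately show ?thesis by simp
qed

text \<open>The mean value inequality is applied along \<open>u\<close> to the difference of
  \<open>f\<close> on two parallel segments, corrected by its expected value. The second-order
  information consists of the differentiability of \<open>D q u\<close> in \<open>q\<close> at the
  single point \<open>p\<close>.\<close>

lemma second_difference_tendsto:
  fixes f :: "'a::real_normed_vector \<Rightarrow> 'b::real_normed_vector"
  assumes S: "open S" "p \<in> S" and D: "\<And>q. q \<in> S \<Longrightarrow> (f has_derivative D q) (at q)"
    and D2: "((\<lambda>q. D q u) has_derivative D2) (at p)"
  shows "((\<lambda>t. (f (p + t *\<^sub>R u + t *\<^sub>R v) - f (p + t *\<^sub>R u) - f (p + t *\<^sub>R v) + f p) /\<^sub>R t\<^sup>2)
    \<longlongrightarrow> D2 v) (at_right 0)"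
proof (rule tendstoI)
  fix e :: real assume e: "e > 0"
  define K where "K = 2 * norm u + norm v + 1"
  have K: "K > 0" unfolding K_def by (simp add: add_nonneg_pos)
  \<comment> \<open>The final bound is \<open>2 * \<epsilon> * K\<close>, which is
    \<open>e / 2\<close>.\<close>
  define \<epsilon> where "\<epsilon> = e / (4 * K)"
  have \<epsilon>: "\<epsilon> > 0" using e K by (simp add: \<epsilon>_def)
  interpret D2: bounded_linear D2 using D2 by (rule has_derivative_bounded_linear)
  obtain r where r: "r > 0" "ball p r \<subseteq> S" using S by (meson open_contains_ball)
  obtain d where d: "d > 0"
    and dd: "\<And>y. norm (y - p) < d \<Longrightarrow> norm (D y u - D p u - D2 (y - p)) \<le> \<epsilon> * norm (y - p)"
    using D2 \<epsilon> unfolding has_derivative_at_alt by blast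
  define \<delta> where "\<delta> = min r d / K"
  have \<delta>: "\<delta> > 0" using r d K by (simp add: \<delta>_def)
  have main: "dist ((f (p + t *\<^sub>R u + t *\<^sub>R v) - f (p + t *\<^sub>R u) - f (p + t *\<^sub>R v) + f p) /\<^sub>R t\<^sup>2) (D2 v) < e"
    if t: "0 < t" "t < \<delta>" for t
  proof -
    have tK: "t * K < min r d" using t K by (simp add: \<delta>_def pos_less_divide_eq)
    \<comment> \<open>The subtracted term makes the derivative \<open>h'\<close> a difference of two
      first-order errors of \<open>D q u\<close> at \<open>p\<close>, of size \<epsilon> times
      \<open>t\<close>. The length \<open>t\<close> of the interval supplies the other factor of the
      required square.\<close>
    define h where "h s = f (p + s *\<^sub>R u + t *\<^sub>R v) - f (p + s *\<^sub>R u) - (s * t) *\<^sub>R D2 v" for s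
    have small: "norm (s *\<^sub>R u + t *\<^sub>R v) \<le> t * K" "norm (s *\<^sub>R u) \<le> t * K"
      if "0 \<le> s" "s \<le> t" for s
    proof -
      have a: "norm (s *\<^sub>R u) \<le> t * norm u" using that by (simp add: mult_right_mono)
      have b: "t * norm u + t * norm v \<le> t * K" "t * norm u \<le> t * K"
        using t unfolding distrib_left[symmetric] by (auto intro!: mult_left_mono simp: K_def)
      show "norm (s *\<^sub>R u) \<le> t * K" using a b(2) by linarith
      have "norm (s *\<^sub>R u + t *\<^sub>R v) \<le> t * norm u + t * norm v"
        using a norm_triangle_ineq[of "s *\<^sub>R u" "t *\<^sub>R v"] t by simp
      also have "\<dots> \<le> t * K" by (rule b)
      finally show "norm (s *\<^sub>R u + t *\<^sub>R v) \<le> t * K" .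
    qed
    define h' where "h' s = (D (p + s *\<^sub>R u + t *\<^sub>R v) u - D (p + s *\<^sub>R u) u - t *\<^sub>R D2 v)" for s
    have hd: "(h has_derivative (\<lambda>k. k *\<^sub>R h' s)) (at s within {0..t})"
      if "s \<in> {0..t}" for s
    proof -
      have inS: "p + s *\<^sub>R u + t *\<^sub>R v \<in> S" "p + s *\<^sub>R u \<in> S"
        using small[of s] that tK r(2) by (auto simp: subset_iff dist_norm add.assoc norm_minus_commute)
      interpret D1: bounded_linear "D (p + s *\<^sub>R u + t *\<^sub>R v)"
        using D[OF inS(1)] by (rule has_derivative_bounded_linear)
      interpret D2': bounded_linear "D (p + s *\<^sub>R u)" 
        using D[OF inS(2)] by (rule has_derivative_bounded_linear)
      have 1: "((\<lambda>s. p + s *\<^sub>R u + t *\<^sub>R v) has_derivative (\<lambda>k. k *\<^sub>R u)) (at s within {0..t})"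
        by (auto intro!: derivative_eq_intros)
      have 2: "((\<lambda>s. p + s *\<^sub>R u) has_derivative (\<lambda>k. k *\<^sub>R u)) (at s within {0..t})"
        by (auto intro!: derivative_eq_intros)
      show ?thesis unfolding h_def
        by (rule derivative_eq_intros has_derivative_compose[OF 1 D[OF inS(1)]]
            has_derivative_compose[OF 2 D[OF inS(2)]] refl)+
          (simp add: h'_def D1.scaleR D2'.scaleR scaleR_diff_right)
    qed
    have bound: "norm (h' s) \<le> 2 * \<epsilon> * (t * K)" if "0 \<le> s" "s \<le> t" for s
    proof -
      have est: "norm (D (p + w) u - D p u - D2 w) \<le> \<epsilon> * (t * K)" if "norm w \<le> t * K" for w
      proof -
        have "norm (D (p + w) u - D p u - D2 w) \<le> \<epsilon> * norm w"
          using dd[of "p + w"] that tK by simp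
        also have "\<dots> \<le> \<epsilon> * (t * K)" using that \<epsilon> by simp
        finally show ?thesis .
      qed
      note 1 = est[OF small(1)[OF that]] and 2 = est[OF small(2)[OF that]]
      have "h' s = (D (p + (s *\<^sub>R u + t *\<^sub>R v)) u - D p u - D2 (s *\<^sub>R u + t *\<^sub>R v))
          - (D (p + s *\<^sub>R u) u - D p u - D2 (s *\<^sub>R u))"
        by (simp add: h'_def D2.add D2.scaleR add.assoc)
      then have "norm (h' s) \<le> \<epsilon> * (t * K) + \<epsilon> * (t * K)"
        using norm_triangle_ineq4 add_mono[OF 1 2] by (metis order_trans)
      also have "\<dots> = 2 * \<epsilon> * (t * K)" by simp
      finally show ?thesis .
    qed
    have "norm (h t - h 0) \<le> 2 * \<epsilon> * (t * K) * norm (t - 0)"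
    proof (rule differentiable_bound[of "{0..t}"])
      show "onorm (\<lambda>k. k *\<^sub>R h' s) \<le> 2 * \<epsilon> * (t * K)" if "s \<in> {0..t}" for s
      proof (rule onorm_le)
        fix k :: real
        show "norm (k *\<^sub>R h' s) \<le> 2 * \<epsilon> * (t * K) * norm k"
          using mult_left_mono[OF bound[of s], of "norm k"] that
          by (simp only: norm_scaleR real_norm_def mult.commute[of _ "\<bar>k\<bar>"]) simp
      qed
      show "(h has_derivative (\<lambda>k. k *\<^sub>R h' s)) (at s within {0..t})" if "s \<in> {0..t}" for s
        using hd[OF that] .
    qed (use t in auto)
    also have "h t - h 0 =
        (f (p + t *\<^sub>R u + t *\<^sub>R v) - f (p + t *\<^sub>R u) - f (p + t *\<^sub>R v) + f p) - t\<^sup>2 *\<^sub>R D2 v"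
      by (simp add: h_def power2_eq_square)
    finally have fin: "norm ((f (p + t *\<^sub>R u + t *\<^sub>R v) - f (p + t *\<^sub>R u) - f (p + t *\<^sub>R v) + f p) - t\<^sup>2 *\<^sub>R D2 v)
        \<le> t\<^sup>2 * (2 * \<epsilon> * K)" (is "norm (?X - _) \<le> _") 
      using t by (simp only: power2_eq_square diff_0_right real_norm_def abs_of_pos mult_ac)
    have "dist (?X /\<^sub>R t\<^sup>2) (D2 v) = norm ((?X - t\<^sup>2 *\<^sub>R D2 v) /\<^sub>R t\<^sup>2)"
      using t by (simp add: dist_norm scaleR_diff_right)
    also have "\<dots> = norm (?X - t\<^sup>2 *\<^sub>R D2 v) / t\<^sup>2" by (simp add: divide_inverse_commute)
    also have "\<dots> \<le> 2 * \<epsilon> * K" using fin t by (simp only: pos_divide_le_eq zero_less_power mult.commute)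
    also have "\<dots> < e" using e K by (simp add: \<epsilon>_def)
    finally show ?thesis .
  qed
  show "\<forall>\<^sub>F t in at_right 0. dist ((f (p + t *\<^sub>R u + t *\<^sub>R v) - f (p + t *\<^sub>R u) - f (p + t *\<^sub>R v) + f p) /\<^sub>R t\<^sup>2) (D2 v) < e"
    unfolding eventually_at_right_field
  proof (intro exI[of _ \<delta>] conjI \<delta> allI impI)
    fix t assume "t > 0" "t < \<delta>"
    then show "dist ((f (p + t *\<^sub>R u + t *\<^sub>R v) - f (p + t *\<^sub>R u) - f (p + t *\<^sub>R v) + f p) /\<^sub>R t\<^sup>2) (D2 v) < e"
      by (rule main)
  qed
qed

text \<open>The second difference does not change when \<open>u\<close> and \<open>v\<close> are
  exchanged, so both iterated derivatives are its limit.\<close>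

lemma second_derivative_symmetric:
  fixes f :: "'a::real_normed_vector \<Rightarrow> 'b::real_normed_vector"
  assumes S: "open S" "p \<in> S" and D: "\<And>q. q \<in> S \<Longrightarrow> (f has_derivative D q) (at q)"
    and u: "((\<lambda>q. D q u) has_derivative D2u) (at p)"
    and v: "((\<lambda>q. D q v) has_derivative D2v) (at p)"
  shows "D2u v = D2v u"
proof -
  have "((\<lambda>t. (f (p + t *\<^sub>R u + t *\<^sub>R v) - f (p + t *\<^sub>R u) - f (p + t *\<^sub>R v) + f p) /\<^sub>R t\<^sup>2)
    \<longlongrightarrow> D2v u) (at_right 0)"
    using second_difference_tendsto[OF S D v, of u] by (simp add: algebra_simps)
  then show ?thesis
    using second_difference_tendsto[OF S D u, of v] tendsto_unique trivial_limit_at_right_real by blast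
qed

text \<open>Poincare lemma on a ball: \<open>f x\<close> is the integral of the form along the
  segment from \<open>a\<close> to \<open>x\<close>. After differentiation under the integral,
  closedness makes the integrand the derivative in \<open>t\<close> of
  \<open>t *\<^sub>R \<omega> (pt x t) v\<close>, so the integral is the form at the end
  point.\<close>

lemma primitive_of_closed_form:
  fixes \<omega> :: "'a::euclidean_space \<Rightarrow> 'a \<Rightarrow> 'b::euclidean_space"
  assumes r: "r > 0" and lin: "\<And>x. x \<in> ball a r \<Longrightarrow> linear (\<omega> x)"
    and D: "\<And>x v. x \<in> ball a r \<Longrightarrow> ((\<lambda>x. \<omega> x v) has_derivative (\<lambda>u. \<omega>' x u v)) (at x)"
    and cont: "\<And>u v. continuous_on (ball a r) (\<lambda>x. \<omega>' x u v)"
    and closed: "\<And>x u v. x \<in> ball a r \<Longrightarrow> \<omega>' x u v = \<omega>' x v u"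
  obtains f where "f a = 0" "\<And>x. x \<in> ball a r \<Longrightarrow> (f has_derivative \<omega> x) (at x)"
proof
  let ?B = "ball a r"
  define pt where "pt x t = a + t *\<^sub>R (x - a)" for x and t :: real
  define g where "g x t = \<omega> (pt x t) (x - a)" for x t
  define f where "f x = integral (cbox 0 1) (g x)" for x
  have pt: "pt x t \<in> ?B" if "x \<in> ?B" "t \<in> {0..1}" for x t
  proof -
    have "norm (t *\<^sub>R (x - a)) \<le> 1 * norm (x - a)"
      using that(2) by (simp add: mult_left_le_one_le)
    then show ?thesis using that(1) by (simp add: pt_def dist_norm norm_minus_commute)
  qed
  have lin': "linear (\<lambda>u. \<omega>' x u v)" if "x \<in> ?B" for x v
    using D[OF that] has_derivative_linear by blast
  \<comment> \<open>Linearity is known in the direction of differentiation, and closedness exchanges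
    the two slots.\<close>
  have lin2: "linear (\<omega>' x u)" if "x \<in> ?B" for x u
  proof -
    have "\<omega>' x u = (\<lambda>v. \<omega>' x v u)" using closed that by auto
    then show ?thesis using lin'[OF that] by simp
  qed
  have contw: "continuous_on ?B (\<lambda>x. \<omega> x v)" for v
    using D by (meson continuous_at_imp_continuous_on has_derivative_continuous)
  define gx where "gx x t v = t *\<^sub>R \<omega>' (pt x t) v (x - a) + \<omega> (pt x t) v" for x t v
  have gxlin: "bounded_linear (gx x t)" if "x \<in> ?B" "t \<in> {0..1}" for x t
    unfolding gx_def
    using lin'[OF pt[OF that], of "x - a"] lin[OF pt[OF that]]
    by (intro bounded_linear_add bounded_linear_const_scaleR) (auto simp: linear_conv_bounded_linear)
  have gd: "((\<lambda>x. g x t) has_derivative gx x t) (at x)" if "x \<in> ?B" "t \<in> {0..1}" for x t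
  proof -
    have "((\<lambda>x. \<omega> (pt x t) (x - a)) has_derivative
       (\<lambda>u. \<omega>' (pt x t) (t *\<^sub>R u) (x - a) + \<omega> (pt x t) u)) (at x)"
      by (rule has_derivative_linear_family[where S = ?B and A' = "\<lambda>u v. \<omega>' (pt x t) u v"])
        (use pt[OF that] lin lin2[OF pt[OF that]] D in
          \<open>auto simp: pt_def intro!: derivative_eq_intros\<close>)
    then show ?thesis
      unfolding g_def gx_def using linear_scale[OF lin'[OF pt[OF that]]] by simp
  qed
  have ptc: "continuous_on (?B \<times> {0..1}) (\<lambda>(x, t). pt x t)"
    unfolding pt_def split_def by (intro continuous_intros)
  have gxc: "continuous_on (?B \<times> {0..1}) (\<lambda>(x, t). gx x t v)" for v
  proof -
    have 1: "continuous_on (?B \<times> {0..1}) (\<lambda>z. \<omega>' (pt (fst z) (snd z)) v b)" for b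
      using continuous_on_compose2[OF cont ptc, of v b] pt by (force simp: split_def)
    have 2: "continuous_on (?B \<times> {0..1}) (\<lambda>z. \<omega> (pt (fst z) (snd z)) v)"
      using continuous_on_compose2[OF contw ptc, of v] pt by (force simp: split_def)
    have "continuous_on (?B \<times> {0..1}) (\<lambda>z. \<omega>' (pt (fst z) (snd z)) v (fst z - a))"
      by (rule continuous_on_linear_family[OF _ 1]) (auto intro!: lin2 pt continuous_intros)
    then show ?thesis unfolding gx_def split_def
      by (intro continuous_intros 2)
  qed
  have fd: "(f has_derivative (\<lambda>v. integral (cbox 0 1) (\<lambda>t. gx x t v))) (at x within ?B)" if x: "x \<in> ?B" for x
  proof -
    have bl: "blinfun_apply (Blinfun (gx x t)) = gx x t" if "x \<in> ?B" "t \<in> {0..1}" for x t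
      using gxlin[OF that] by (rule bounded_linear_Blinfun_apply)
    \<comment> \<open>\<open>leibniz_rule\<close> wants the derivative as a continuous map into
      bounded linear maps; in finite dimension this may be checked one vector at a time.\<close>
    have cb: "continuous_on (?B \<times> cbox 0 1) (\<lambda>(x, t). Blinfun (gx x t))"
    proof (rule continuous_on_blinfun_componentwise)
      fix i :: 'a
      show "continuous_on (?B \<times> cbox 0 1) (\<lambda>z. blinfun_apply (case z of (x, t) \<Rightarrow> Blinfun (gx x t)) i)"
        using gxc[of i] by (rule continuous_on_cong[THEN iffD1, rotated 2]) (auto simp: bl)
    qed
    have 0: "(f has_derivative blinfun_apply (integral (cbox 0 1) (\<lambda>t. Blinfun (gx x t)))) (at x within ?B)"
      unfolding f_def
    proof (rule leibniz_rule[where U = ?B and fx = "\<lambda>x t. Blinfun (gx x t)"])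
      show "((\<lambda>x. g x t) has_derivative blinfun_apply (Blinfun (gx x t))) (at x within ?B)"
        if "x \<in> ?B" "t \<in> cbox 0 1" for x t
        using gd[of x t] that by (simp add: bl has_derivative_at_withinI)
      show "g x integrable_on cbox 0 1" if "x \<in> ?B" for x
      proof (rule integrable_continuous)
        have "continuous_on (cbox 0 1) (pt x)" unfolding pt_def by (intro continuous_intros)
        then show "continuous_on (cbox 0 1) (g x)"
          unfolding g_def using continuous_on_compose2[OF contw, of "cbox 0 1" "pt x" "x - a"] pt that by force
      qed
    qed (use x cb in auto)
    have "continuous_on (cbox 0 1) (\<lambda>t. Blinfun (gx x t))"
      using continuous_on_compose2[OF cb, of "cbox 0 1" "\<lambda>t. (x, t)"] x
      by (force intro: continuous_intros)
    then have "(\<lambda>t. Blinfun (gx x t)) integrable_on cbox 0 1" by (rule integrable_continuous)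
    from blinfun_apply_integral[OF this]
    have "blinfun_apply (integral (cbox 0 1) (\<lambda>t. Blinfun (gx x t))) v
        = integral (cbox 0 1) (\<lambda>t. gx x t v)" for v
      using x bl by (auto intro!: integral_cong)
    then have "blinfun_apply (integral (cbox 0 1) (\<lambda>t. Blinfun (gx x t)))
        = (\<lambda>v. integral (cbox 0 1) (\<lambda>t. gx x t v))" by (rule ext)
    with 0 show ?thesis by simp
  qed
  have int: "integral (cbox 0 1) (\<lambda>t. gx x t v) = \<omega> x v" if x: "x \<in> ?B" for x v
  proof -
    have "((\<lambda>t. gx x t v) has_integral (1 *\<^sub>R \<omega> (pt x 1) v - 0 *\<^sub>R \<omega> (pt x 0) v)) {0..1}"
    proof (rule fundamental_theorem_of_calculus)
      fix t :: real assume t: "t \<in> {0..1}"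
      have 1: "(pt x has_derivative (\<lambda>k. k *\<^sub>R (x - a))) (at t)"
        unfolding pt_def by (auto intro!: derivative_eq_intros)
      have "((\<lambda>t. \<omega> (pt x t) v) has_derivative (\<lambda>k. \<omega>' (pt x t) (k *\<^sub>R (x - a)) v)) (at t)"
        by (rule has_derivative_compose[OF 1 D[OF pt[OF x t]]])
      then have "((\<lambda>t. t *\<^sub>R \<omega> (pt x t) v) has_derivative
          (\<lambda>k. t *\<^sub>R \<omega>' (pt x t) (k *\<^sub>R (x - a)) v + k *\<^sub>R \<omega> (pt x t) v)) (at t)"
        by (rule has_derivative_scaleR[OF has_derivative_ident])
      also have "(\<lambda>k. t *\<^sub>R \<omega>' (pt x t) (k *\<^sub>R (x - a)) v + k *\<^sub>R \<omega> (pt x t) v) = (\<lambda>k. k *\<^sub>R gx x t v)"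
        unfolding gx_def linear_scale[OF lin'[OF pt[OF x t]]] closed[OF pt[OF x t], of "x - a"]
        by (simp add: scaleR_add_right mult.commute)
      finally show "((\<lambda>t. t *\<^sub>R \<omega> (pt x t) v) has_vector_derivative gx x t v) (at t within {0..1})"
        by (simp add: has_vector_derivative_def has_derivative_at_withinI)
    qed simp
    from integral_unique[OF this] show ?thesis by (simp add: pt_def)
  qed
  show "(f has_derivative \<omega> x) (at x)" if "x \<in> ?B" for x
    using fd[OF that] int[OF that] at_within_open[OF that open_ball] by simp
  show "f a = 0"
  proof -
    have "linear (\<omega> a)" using lin r by simp
    then have "g a = (\<lambda>t. 0)" by (simp add: g_def pt_def linear_0 fun_eq_iff)
    then show ?thesis by (simp add: f_def)
  qed
qed

section \<open>First and second derivatives of a twice continuously differentiable map\<close>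

locale C2_map =
  fixes f :: "'a::euclidean_space \<Rightarrow> 'b::euclidean_space" and S :: "'a set"
  assumes open_dom: "open S" and C2: "Ck_on 2 f S"
begin

definition D1 :: "'a \<Rightarrow> 'a \<Rightarrow> 'b" where
  "D1 p v = frechet_derivative f (at p) v"

text \<open>The first vector is the direction in which the base point moves, the second is the
  argument of \<open>D1\<close>. Linearity in the second slot is not visible from this form and
  comes from the symmetry of second derivatives.\<close>

definition D2 :: "'a \<Rightarrow> 'a \<Rightarrow> 'a \<Rightarrow> 'b" where
  "D2 p u v = frechet_derivative (\<lambda>q. D1 q v) (at p) u"

lemma has_derivative_D1: "p \<in> S \<Longrightarrow> (f has_derivative D1 p) (at p)"
  using C2 by (simp add: D1_def[abs_def] numeral_2_eq_2 frechet_derivative_works)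

lemma has_derivative_D2: "p \<in> S \<Longrightarrow> ((\<lambda>q. D1 q v) has_derivative (\<lambda>u. D2 p u v)) (at p)"
  using C2 by (simp add: D1_def[abs_def] D2_def numeral_2_eq_2 frechet_derivative_works)

lemma linear_D1: "p \<in> S \<Longrightarrow> linear (D1 p)"
  by (rule has_derivative_linear[OF has_derivative_D1])

lemma linear_D2_left: "p \<in> S \<Longrightarrow> linear (\<lambda>u. D2 p u v)"
  by (rule has_derivative_linear[OF has_derivative_D2])

lemma D2_commute: "p \<in> S \<Longrightarrow> D2 p u v = D2 p v u"
  by (rule second_derivative_symmetric[OF open_dom _ has_derivative_D1 has_derivative_D2 has_derivative_D2])

lemma linear_D2_right:
  assumes "p \<in> S"
  shows "linear (D2 p u)"
proof -
  have "D2 p u = (\<lambda>v. D2 p v u)" using D2_commute[OF assms] by blast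
  then show ?thesis using linear_D2_left[OF assms] by simp
qed

lemma has_derivative_D1_compose:
  assumes "c x \<in> S" "(c has_derivative c') (at x)" "(w has_derivative w') (at x)"
  shows "((\<lambda>x. D1 (c x) (w x)) has_derivative (\<lambda>u. D2 (c x) (c' u) (w x) + D1 (c x) (w' u))) (at x)"
  by (rule has_derivative_linear_family[OF open_dom assms(1) linear_D1 linear_D2_right[OF assms(1)]
        has_derivative_D2[OF assms(1)] assms(2,3)])

lemma has_derivative_compose_D1:
  assumes "c x \<in> S" "(c has_derivative c') (at x)"
  shows "((\<lambda>x. f (c x)) has_derivative (\<lambda>u. D1 (c x) (c' u))) (at x)"
  by (rule has_derivative_compose[OF assms(2) has_derivative_D1[OF assms(1)]])

lemma continuous_on_dom: "continuous_on S f"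
  using has_derivative_D1 by (meson continuous_at_imp_continuous_on has_derivative_continuous)

lemma continuous_on_D1_const: "continuous_on S (\<lambda>q. D1 q v)"
  using has_derivative_D2 by (meson continuous_at_imp_continuous_on has_derivative_continuous)

lemma continuous_on_D2_const: "continuous_on S (\<lambda>q. D2 q u v)"
  using C2 by (simp add: D1_def[abs_def] D2_def numeral_2_eq_2)

lemma continuous_on_D1:
  assumes "continuous_on A c" "continuous_on A v" "c ` A \<subseteq> S"
  shows "continuous_on A (\<lambda>x. D1 (c x) (v x))"
  by (rule continuous_on_linear_family[where A = "\<lambda>x. D1 (c x)"])
    (use assms in \<open>auto intro!: linear_D1 continuous_on_compose2[OF continuous_on_D1_const]\<close>)

lemma continuous_on_D2:
  assumes "continuous_on A c" "continuous_on A u" "continuous_on A v" "c ` A \<subseteq> S"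
  shows "continuous_on A (\<lambda>x. D2 (c x) (u x) (v x))"
proof (rule continuous_on_linear_family[where A = "\<lambda>x. D2 (c x) (u x)"])
  show "continuous_on A (\<lambda>x. D2 (c x) (u x) b)" for b
    by (rule continuous_on_linear_family[where A = "\<lambda>x u. D2 (c x) u b"])
      (use assms in \<open>auto intro!: linear_D2_left continuous_on_compose2[OF continuous_on_D2_const]\<close>)
qed (use assms in \<open>auto intro!: linear_D2_right\<close>)

end

section \<open>Topological groups\<close>

abbreviation (in monoid) lprod :: "'a list \<Rightarrow> 'a" where
  "lprod xs \<equiv> foldr (\<otimes>) xs \<one>"

definition (in group) comm :: "'a \<Rightarrow> 'a \<Rightarrow> 'a" where
  "comm x y = x \<otimes> y \<otimes> inv x \<otimes> inv y"

lemma (in monoid) lprod_closed: "set xs \<subseteq> carrier G \<Longrightarrow> lprod xs \<in> carrier G"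
  by (induction xs) auto

lemma (in group) comm_closed: "x \<in> carrier G \<Longrightarrow> y \<in> carrier G \<Longrightarrow> comm x y \<in> carrier G"
  by (simp add: comm_def)

lemma (in group) inv_mult_cancel_left:
  assumes "x \<in> carrier G" "y \<in> carrier G"
  shows "inv x \<otimes> (x \<otimes> y) = y" "x \<otimes> (inv x \<otimes> y) = y"
  using assms by (simp_all add: m_assoc[symmetric])

lemma (in group) comm_eq_one_iff:
  assumes "x \<in> carrier G" "y \<in> carrier G"
  shows "comm x y = \<one> \<longleftrightarrow> x \<otimes> y = y \<otimes> x"
proof -
  have "comm x y = (x \<otimes> y) \<otimes> inv (y \<otimes> x)"
    using assms by (simp add: comm_def inv_mult_group m_assoc)
  then show ?thesis using assms by (metis inv_closed inv_equality inv_inv m_closed r_inv)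
qed

lemma (in group_hom) hom_comm:
  assumes "x \<in> carrier G" "y \<in> carrier G"
  shows "h (G.comm x y) = H.comm (h x) (h y)"
  using assms by (simp add: G.comm_def H.comm_def)

lemma (in group_hom) hom_lprod:
  "set xs \<subseteq> carrier G \<Longrightarrow> h (G.lprod xs) = H.lprod (map h xs)"
  by (induction xs) (auto simp: G.lprod_closed)

section \<open>Neighborhoods of the identity, compactness and closures\<close>

locale top_group = group G for G :: "('a, 'r) monoid_scheme" (structure) and T :: "'a topology" +
  assumes topspace_eq: "topspace T = carrier G"
    and continuous_mult': "continuous_map (prod_topology T T) T (\<lambda>(x, y). x \<otimes> y)"
    and continuous_inv': "continuous_map T T (\<lambda>x. inv x)"
begin

lemma continuous_mult:
  assumes "continuous_map X T f" "continuous_map X T g"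
  shows "continuous_map X T (\<lambda>x. f x \<otimes> g x)"
proof -
  have "continuous_map X (prod_topology T T) (\<lambda>x. (f x, g x))"
    using assms by (simp add: continuous_map_pairedI)
  from continuous_map_compose[OF this continuous_mult'] show ?thesis by (simp add: o_def)
qed

lemma continuous_inv: "continuous_map X T f \<Longrightarrow> continuous_map X T (\<lambda>x. inv (f x))"
  using continuous_map_compose[OF _ continuous_inv', of X f] by (simp add: o_def)

lemma continuous_comm:
  assumes "continuous_map X T f" "continuous_map X T g"
  shows "continuous_map X T (\<lambda>x. comm (f x) (g x))"
  unfolding comm_def by (intro continuous_mult continuous_inv assms)

lemma openin_carrier: "openin T U \<Longrightarrow> x \<in> U \<Longrightarrow> x \<in> carrier G"
  using openin_subset topspace_eq by blast

lemma one_in_topspace: "\<one> \<in> topspace T"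
  by (simp add: topspace_eq)

lemma nbhd_two_variables:
  assumes f: "continuous_map (prod_topology T T) T (\<lambda>(x, y). f x y)"
    and V: "openin T V" "f \<one> \<one> \<in> V"
  obtains W where "openin T W" "\<one> \<in> W" "\<And>x y. x \<in> W \<Longrightarrow> y \<in> W \<Longrightarrow> f x y \<in> V"
proof -
  let ?Q = "{z \<in> topspace (prod_topology T T). (case z of (x, y) \<Rightarrow> f x y) \<in> V}"
  have "openin (prod_topology T T) ?Q"
    using f V(1) by (rule openin_continuous_map_preimage)
  moreover have "(\<one>, \<one>) \<in> ?Q" using V(2) by (simp add: topspace_eq)
  ultimately obtain A B where AB: "openin T A" "openin T B" "\<one> \<in> A" "\<one> \<in> B" "A \<times> B \<subseteq> ?Q"
    unfolding openin_prod_topology_alt by meson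
  have "f x y \<in> V" if "x \<in> A \<inter> B" "y \<in> A \<inter> B" for x y
  proof -
    have "(x, y) \<in> ?Q" using AB(5) that by blast
    then show ?thesis by simp
  qed
  with AB show thesis by (intro that[of "A \<inter> B"]) auto
qed

lemma nbhd_mult:
  assumes "openin T V" "\<one> \<in> V"
  obtains W where "openin T W" "\<one> \<in> W" "\<And>x y. x \<in> W \<Longrightarrow> y \<in> W \<Longrightarrow> x \<otimes> y \<in> V"
  using nbhd_two_variables[of "\<lambda>x y. x \<otimes> y" V] continuous_mult' assms by auto

lemma nbhd_inv_mult:
  assumes "openin T V" "\<one> \<in> V"
  obtains W where "openin T W" "\<one> \<in> W" "\<And>x y. x \<in> W \<Longrightarrow> y \<in> W \<Longrightarrow> inv x \<otimes> y \<in> V"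
proof (rule nbhd_two_variables[of "\<lambda>x y. inv x \<otimes> y" V])
  show "continuous_map (prod_topology T T) T (\<lambda>(x, y). inv x \<otimes> y)"
    unfolding split_def
    by (intro continuous_mult continuous_inv continuous_map_fst continuous_map_snd)
qed (use assms in auto)

lemma nbhd_lprod:
  assumes "openin T V" "\<one> \<in> V"
  obtains W where "openin T W" "\<one> \<in> W" "W \<subseteq> V"
    "\<And>xs. length xs \<le> n \<Longrightarrow> set xs \<subseteq> W \<Longrightarrow> lprod xs \<in> V"
proof -
  have "\<exists>W. openin T W \<and> \<one> \<in> W \<and> W \<subseteq> V \<and> (\<forall>xs. length xs \<le> n \<longrightarrow> set xs \<subseteq> W \<longrightarrow> lprod xs \<in> V)"
    using assms
  proof (induction n arbitrary: V)
    case 0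
    then show ?case by auto
  next
    case (Suc n)
    obtain V1 where V1: "openin T V1" "\<one> \<in> V1" "\<And>x y. x \<in> V1 \<Longrightarrow> y \<in> V1 \<Longrightarrow> x \<otimes> y \<in> V"
      using nbhd_mult[OF Suc.prems] by blast
    from Suc.IH[OF V1(1,2)] obtain W where W: "openin T W" "\<one> \<in> W" "W \<subseteq> V1"
      "\<And>xs. length xs \<le> n \<Longrightarrow> set xs \<subseteq> W \<Longrightarrow> lprod xs \<in> V1" by blast
    have "lprod xs \<in> V" if xs: "length xs \<le> Suc n" "set xs \<subseteq> W" for xs
    proof (cases xs)
      case Nil
      then show ?thesis using Suc.prems by simp
    next
      case (Cons y ys)
      then show ?thesis using xs W(3) by (auto intro!: V1(3) W(4))
    qed
    moreover have "W \<subseteq> V"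
    proof
      fix x assume "x \<in> W"
      with W(3) V1(2) have "x \<otimes> \<one> \<in> V" by (blast intro: V1(3))
      with openin_carrier[OF W(1) \<open>x \<in> W\<close>] show "x \<in> V" by simp
    qed
    ultimately show ?case using W(1,2) by blast
  qed
  then show thesis using that by blast
qed

lemma nbhd_symmetric:
  assumes "openin T V" "\<one> \<in> V"
  obtains W where "openin T W" "\<one> \<in> W" "W \<subseteq> V" "\<And>x. x \<in> W \<Longrightarrow> inv x \<in> W"
proof
  let ?W = "{x \<in> topspace T. inv x \<in> V} \<inter> V"
  show "openin T ?W"
    using openin_continuous_map_preimage[OF continuous_inv' assms(1)] assms(1) by blast
qed (use assms openin_carrier in \<open>auto simp: topspace_eq\<close>)

text \<open>Conjugation fixes the identity, so \<open>C \<times> {\<one>}\<close> lies in the open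
  preimage of \<open>V\<close>. By the tube lemma a whole strip around it does too, which gives one
  \<open>W\<close> for all elements of \<open>C\<close>.\<close>

lemma nbhd_conjugate_compact:
  assumes V: "openin T V" "\<one> \<in> V" and C: "compactin T C"
  obtains W where "openin T W" "\<one> \<in> W" "\<And>w c. w \<in> W \<Longrightarrow> c \<in> C \<Longrightarrow> c \<otimes> w \<otimes> inv c \<in> V"
proof -
  have cont: "continuous_map (prod_topology T T) T (\<lambda>z. fst z \<otimes> snd z \<otimes> inv (fst z))"
    by (intro continuous_mult continuous_inv continuous_map_fst continuous_map_snd)
  let ?Q = "{z \<in> topspace (prod_topology T T). fst z \<otimes> snd z \<otimes> inv (fst z) \<in> V}"
  have Q: "openin (prod_topology T T) ?Q"
    using cont V(1) by (rule openin_continuous_map_preimage)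
  have "C \<subseteq> carrier G" using compactin_subset_topspace[OF C] by (simp add: topspace_eq)
  then have CQ: "C \<times> {\<one>} \<subseteq> ?Q" using V by (auto simp: topspace_eq)
  have one: "compactin T {\<one>}" by (simp add: topspace_eq)
  obtain A B where "openin T A" "openin T B" "C \<subseteq> A" "{\<one>} \<subseteq> B" and sub: "A \<times> B \<subseteq> ?Q"
    by (rule Wallace_theorem_prod_topology[OF C one Q CQ])
  moreover have "c \<otimes> w \<otimes> inv c \<in> V" if "w \<in> B" "c \<in> C" for w c
  proof -
    have "(c, w) \<in> ?Q" using sub that \<open>C \<subseteq> A\<close> by blast
    then show ?thesis by simp
  qed
  ultimately show thesis by (intro that[of B]) auto
qed

text \<open>\<open>M\<close> is the number of translates in a finite cover of \<open>C\<close>, so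
  among \<open>M + 1\<close> terms two share a translate, and their quotient is small. The bound
  depends on \<open>W\<close> and \<open>C\<close> but not on the sequence.\<close>

lemma pigeonhole_compact:
  assumes W: "openin T W" "\<one> \<in> W" and C: "compactin T C"
  obtains M :: nat where
    "\<And>f :: nat \<Rightarrow> 'a. (\<And>k. k \<le> M \<Longrightarrow> f k \<in> C) \<Longrightarrow> \<exists>k l. k < l \<and> l \<le> M \<and> inv (f k) \<otimes> f l \<in> W"
proof -
  obtain V where V: "openin T V" "\<one> \<in> V" "\<And>x y. x \<in> V \<Longrightarrow> y \<in> V \<Longrightarrow> inv x \<otimes> y \<in> W"
    using nbhd_inv_mult[OF W] by blast
  define N where "N c = {y \<in> topspace T. inv c \<otimes> y \<in> V}" for c
  have CG: "C \<subseteq> carrier G" using compactin_subset_topspace[OF C] by (simp add: topspace_eq)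
  have N: "openin T (N c)" if "c \<in> C" for c
    unfolding N_def
    by (rule openin_continuous_map_preimage[OF continuous_mult V(1)])
      (use that CG in \<open>auto simp: topspace_eq\<close>)
  have "C \<subseteq> \<Union> (N ` C)"
  proof
    fix x assume "x \<in> C"
    then show "x \<in> \<Union> (N ` C)" using CG V(2) by (intro UN_I[of x]) (auto simp: N_def topspace_eq)
  qed
  then obtain \<F> where "finite \<F>" "\<F> \<subseteq> N ` C" "C \<subseteq> \<Union> \<F>"
    using compactinD[OF C, of "N ` C"] N by blast
  then obtain F where F: "finite F" "F \<subseteq> C" "C \<subseteq> \<Union> (N ` F)"
    by (metis finite_subset_image)
  show thesis
  proof
    fix f :: "nat \<Rightarrow> 'a"
    assume f: "\<And>k. k \<le> card F \<Longrightarrow> f k \<in> C"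
    have "\<forall>k\<in>{..card F}. \<exists>c\<in>F. f k \<in> N c" using f F(3) by blast
    then have "\<forall>k\<in>{..card F}. \<exists>c. c \<in> F \<and> f k \<in> N c" by blast
    from bchoice[OF this] obtain c where c: "\<And>k. k \<le> card F \<Longrightarrow> c k \<in> F \<and> f k \<in> N (c k)"
      by auto
    have "\<not> inj_on c {..card F}"
    proof
      assume "inj_on c {..card F}"
      then have "card {..card F} \<le> card F" using c F(1) by (intro card_inj_on_le[of c]) auto
      then show False by simp
    qed
    then obtain i j where ij: "i \<le> card F" "j \<le> card F" "c i = c j" "i \<noteq> j"
      unfolding inj_on_def by auto
    obtain k l where kl: "k < l" "l \<le> card F" "c k = c l"
    proof (cases "i < j")
      case True
      then show thesis using that[of i j] ij by simp
    next
      case False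
      then show thesis using that[of j i] ij by simp
    qed
    have "inv (inv (c k) \<otimes> f k) \<otimes> (inv (c k) \<otimes> f l) \<in> W"
      using c[of k] c[of l] kl by (intro V(3)) (auto simp: N_def)
    moreover have "inv (inv (c k) \<otimes> f k) \<otimes> (inv (c k) \<otimes> f l) = inv (f k) \<otimes> f l"
      using c[of k] c[of l] f[of k] f[of l] kl F(2) CG
      by (simp add: inv_mult_group m_assoc inv_mult_cancel_left subset_iff)
    ultimately show "\<exists>k l. k < l \<and> l \<le> card F \<and> inv (f k) \<otimes> f l \<in> W" using kl by metis
  qed
qed

lemma closure_of_mult:
  assumes "a \<in> T closure_of A" "b \<in> T closure_of B"
  shows "a \<otimes> b \<in> T closure_of ((\<lambda>(x, y). x \<otimes> y) ` (A \<times> B))"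
proof -
  have "(a, b) \<in> prod_topology T T closure_of (A \<times> B)"
    using assms by (simp add: closure_of_Times)
  then show ?thesis
    using continuous_map_image_closure_subset[OF continuous_mult', of "A \<times> B"] by force
qed

lemma closure_of_comm:
  assumes "a \<in> T closure_of A" "b \<in> T closure_of B"
  shows "comm a b \<in> T closure_of ((\<lambda>(x, y). comm x y) ` (A \<times> B))"
proof -
  have "(a, b) \<in> prod_topology T T closure_of (A \<times> B)"
    using assms by (simp add: closure_of_Times)
  moreover have "continuous_map (prod_topology T T) T (\<lambda>(x, y). comm x y)"
    unfolding split_def by (intro continuous_comm continuous_map_fst continuous_map_snd)
  ultimately show ?thesis
    using continuous_map_image_closure_subset[of _ _ "\<lambda>(x, y). comm x y" "A \<times> B"] by force
qed

lemma closure_of_inv: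
  assumes "a \<in> T closure_of A"
  shows "inv a \<in> T closure_of ((\<lambda>x. inv x) ` A)"
  using continuous_map_image_closure_subset[OF continuous_inv', of A] assms by blast

text \<open>The \<open>y\<close> for which \<open>z \<otimes> inv y\<close> lies in \<open>V\<close>
  form a neighborhood of \<open>z\<close>, which meets \<open>A\<close>. This bounds a closure by a
  product with a neighborhood of the identity.\<close>

lemma closure_of_subset_mult:
  assumes V: "openin T V" "\<one> \<in> V" and z: "z \<in> T closure_of A"
  obtains v a where "v \<in> V" "a \<in> A" "z = v \<otimes> a"
proof -
  have zG: "z \<in> carrier G" using z closure_of_subset_topspace[of T A] topspace_eq by blast
  define Q where "Q = {y \<in> topspace T. z \<otimes> inv y \<in> V}"
  have "openin T Q" unfolding Q_def
    by (rule openin_continuous_map_preimage[OF continuous_mult[OF _ continuous_inv'] V(1)])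
      (use zG in \<open>simp add: topspace_eq\<close>)
  moreover have "z \<in> Q" using V zG by (simp add: Q_def topspace_eq)
  ultimately obtain y where y: "y \<in> A" "y \<in> Q" using z unfolding in_closure_of by blast
  have "z = (z \<otimes> inv y) \<otimes> y" using y zG by (simp add: m_assoc topspace_eq Q_def)
  then show thesis using y by (intro that[of "z \<otimes> inv y" y]) (auto simp: Q_def)
qed

text \<open>The point is that the number \<open>n\<close> of factors depends neither on \<open>P\<close> nor on \<open>M\<close>.\<close>

definition controlled_commutators :: "nat \<Rightarrow> bool" where
  "controlled_commutators n \<longleftrightarrow>
    (\<forall>U P. \<forall>M::nat. openin T U \<longrightarrow> \<one> \<in> U \<longrightarrow> P \<subseteq> U \<longrightarrow>
      (\<forall>g\<in>carrier G. (\<forall>k\<le>M. g [^] k \<in> U) \<longrightarrow> (\<exists>k\<in>{1..M}. g [^] k \<in> P)) \<longrightarrow>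
      (\<exists>V. openin T V \<and> \<one> \<in> V \<and> (\<forall>g\<in>V. \<forall>h\<in>V. \<exists>ps. length ps \<le> n \<and> set ps \<subseteq> P \<times> U \<and>
        comm g h = lprod (map (\<lambda>(p, x). comm p x) ps))))"

end

section \<open>From controlled commutators to the discontinuity group\<close>

text \<open>The operations of \<open>H\<close> carry closures into closures, and every neighborhood
  of the identity of \<open>G\<close> contains one whose products, or inverses, stay inside
  it.\<close>

lemma DG_subgroup:
  assumes "top_group G S" "top_group H T" "\<pi> \<in> hom G H"
  shows "subgroup (DG G S T \<pi>) H"
proof -
  interpret G: top_group G S by fact
  interpret H: top_group H T by fact
  interpret group_hom G H \<pi> by unfold_locales fact
  have mem: "a \<in> DG G S T \<pi> \<longleftrightarrow> (\<forall>V. openin S V \<longrightarrow> \<one>\<^bsub>G\<^esub> \<in> V \<longrightarrow> a \<in> T closure_of (\<pi> ` V))" for a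
  proof
    assume "a \<in> DG G S T \<pi>"
    then show "\<forall>V. openin S V \<longrightarrow> \<one>\<^bsub>G\<^esub> \<in> V \<longrightarrow> a \<in> T closure_of (\<pi> ` V)"
      by (auto simp: DG_def nbhds_def dest: openin_subset)
  next
    assume *: "\<forall>V. openin S V \<longrightarrow> \<one>\<^bsub>G\<^esub> \<in> V \<longrightarrow> a \<in> T closure_of (\<pi> ` V)"
    show "a \<in> DG G S T \<pi>" unfolding DG_def
    proof
      fix N assume "N \<in> nbhds S \<one>\<^bsub>G\<^esub>"
      then obtain V where "openin S V" "\<one>\<^bsub>G\<^esub> \<in> V" "V \<subseteq> N" by (auto simp: nbhds_def)
      with * have "a \<in> T closure_of (\<pi> ` V)" by simp
      with closure_of_mono[OF image_mono[OF \<open>V \<subseteq> N\<close>]] show "a \<in> T closure_of (\<pi> ` N)" by (rule subsetD)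
    qed
  qed
  show ?thesis
  proof (rule H.subgroupI)
    show "DG G S T \<pi> \<subseteq> carrier H"
    proof
      fix a assume "a \<in> DG G S T \<pi>"
      then have "a \<in> T closure_of (\<pi> ` topspace S)"
        using mem[of a] openin_topspace G.one_in_topspace by simp
      then show "a \<in> carrier H"
        using closure_of_subset_topspace[of T] by (auto simp: H.topspace_eq)
    qed
    have "\<one>\<^bsub>H\<^esub> \<in> DG G S T \<pi>" unfolding mem
    proof (intro allI impI)
      fix V assume "openin S V" "\<one>\<^bsub>G\<^esub> \<in> V"
      then have "\<pi> \<one>\<^bsub>G\<^esub> \<in> \<pi> ` V" by (intro imageI)
      then have "\<one>\<^bsub>H\<^esub> \<in> topspace T \<inter> \<pi> ` V"
        using H.one_in_topspace by simp
      with closure_of_subset_Int[of T "\<pi> ` V"] show "\<one>\<^bsub>H\<^esub> \<in> T closure_of (\<pi> ` V)" by (rule subsetD)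
    qed
    then show "DG G S T \<pi> \<noteq> {}" by blast
  next
    fix a assume a: "a \<in> DG G S T \<pi>"
    show "inv\<^bsub>H\<^esub> a \<in> DG G S T \<pi>" unfolding mem
    proof (intro allI impI)
      fix V assume "openin S V" "\<one>\<^bsub>G\<^esub> \<in> V"
      then obtain W where W: "openin S W" "\<one>\<^bsub>G\<^esub> \<in> W" "W \<subseteq> V" "\<And>x. x \<in> W \<Longrightarrow> inv\<^bsub>G\<^esub> x \<in> W"
        using G.nbhd_symmetric by blast
      have "inv\<^bsub>H\<^esub> a \<in> T closure_of ((\<lambda>x. inv\<^bsub>H\<^esub> x) ` \<pi> ` W)"
        using a W unfolding mem by (intro H.closure_of_inv) blast
      moreover have "(\<lambda>x. inv\<^bsub>H\<^esub> x) ` \<pi> ` W \<subseteq> \<pi> ` V"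
      proof
        fix y assume "y \<in> (\<lambda>x. inv\<^bsub>H\<^esub> x) ` \<pi> ` W"
        then obtain w where w: "w \<in> W" "y = inv\<^bsub>H\<^esub> (\<pi> w)" by blast
        then have "y = \<pi> (inv\<^bsub>G\<^esub> w)" using G.openin_carrier[OF W(1)] by simp
        with w W show "y \<in> \<pi> ` V" by blast
      qed
      ultimately show "inv\<^bsub>H\<^esub> a \<in> T closure_of (\<pi> ` V)" by (rule closure_of_mono[THEN subsetD, rotated])
    qed
  next
    fix a b assume ab: "a \<in> DG G S T \<pi>" "b \<in> DG G S T \<pi>"
    show "a \<otimes>\<^bsub>H\<^esub> b \<in> DG G S T \<pi>" unfolding mem
    proof (intro allI impI)
      fix V assume "openin S V" "\<one>\<^bsub>G\<^esub> \<in> V"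
      then obtain W where W: "openin S W" "\<one>\<^bsub>G\<^esub> \<in> W" "\<And>x y. x \<in> W \<Longrightarrow> y \<in> W \<Longrightarrow> x \<otimes>\<^bsub>G\<^esub> y \<in> V"
        using G.nbhd_mult by blast
      have "a \<otimes>\<^bsub>H\<^esub> b \<in> T closure_of ((\<lambda>(x, y). x \<otimes>\<^bsub>H\<^esub> y) ` (\<pi> ` W \<times> \<pi> ` W))"
        using ab W unfolding mem by (intro H.closure_of_mult) blast+
      moreover have "(\<lambda>(x, y). x \<otimes>\<^bsub>H\<^esub> y) ` (\<pi> ` W \<times> \<pi> ` W) \<subseteq> \<pi> ` V"
      proof
        fix y assume "y \<in> (\<lambda>(x, y). x \<otimes>\<^bsub>H\<^esub> y) ` (\<pi> ` W \<times> \<pi> ` W)"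
        then obtain v w where w: "v \<in> W" "w \<in> W" "y = \<pi> v \<otimes>\<^bsub>H\<^esub> \<pi> w" by auto
        then have "y = \<pi> (v \<otimes>\<^bsub>G\<^esub> w)" using G.openin_carrier[OF W(1)] by simp
        with w W show "y \<in> \<pi> ` V" by blast
      qed
      ultimately show "a \<otimes>\<^bsub>H\<^esub> b \<in> T closure_of (\<pi> ` V)" by (rule closure_of_mono[THEN subsetD, rotated])
    qed
  qed
qed

text \<open>In a Hausdorff group it suffices that commutators of elements of the discontinuity group
  lie in every neighborhood of the identity, which is the fact \<open>small\<close>.\<close>

lemma DG_comm_group:
  assumes "top_group G S" "top_group H T" and T: "Hausdorff_space T" and "\<pi> \<in> hom G H"
    and lb: "locally_bounded G S H T \<pi>"
    and width: "top_group.controlled_commutators G S n"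
  shows "comm_group (H\<lparr>carrier := DG G S T \<pi>\<rparr>)"
proof -
  interpret G: top_group G S by fact
  interpret H: top_group H T by fact
  interpret group_hom G H \<pi> by unfold_locales fact
  let ?D = "DG G S T \<pi>"
  have sub: "subgroup ?D H" by (rule DG_subgroup) fact+
  obtain U C where U: "openin S U" "\<one>\<^bsub>G\<^esub> \<in> U" and C: "compactin T C" "\<pi> ` U \<subseteq> C"
  proof -
    from lb obtain N V where N: "N \<in> nbhds S \<one>\<^bsub>G\<^esub>" and V: "V \<in> nbhds T \<one>\<^bsub>H\<^esub>"
      and NV: "\<pi> ` N \<subseteq> V" "compactin T (T closure_of V)"
      unfolding locally_bounded_def by blast
    from N obtain U where "openin S U" "\<one>\<^bsub>G\<^esub> \<in> U" "U \<subseteq> N" by (auto simp: nbhds_def)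
    moreover have "V \<subseteq> T closure_of V" using V by (intro closure_of_subset) (auto simp: nbhds_def)
    ultimately show thesis using that NV by blast
  qed
  have small: "H.comm a b \<in> V" if V: "openin T V" "\<one>\<^bsub>H\<^esub> \<in> V" and ab: "a \<in> ?D" "b \<in> ?D" for V a b
  proof -
    \<comment> \<open>The limit argument will end in the closure of \<open>V1\<close>, which is
      contained in the product of \<open>V1\<close> with itself.\<close>
    obtain V1 where V1: "openin T V1" "\<one>\<^bsub>H\<^esub> \<in> V1" "\<And>x y. x \<in> V1 \<Longrightarrow> y \<in> V1 \<Longrightarrow> x \<otimes>\<^bsub>H\<^esub> y \<in> V"
      using H.nbhd_mult[OF V] by blast
    \<comment> \<open>This is the place where \<open>n\<close> must already be known:
      \<open>W\<close>, \<open>M\<close> and \<open>P\<close> are all chosen later.\<close>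
    obtain V2 where V2: "openin T V2" "\<one>\<^bsub>H\<^esub> \<in> V2"
      "\<And>xs. length xs \<le> n \<Longrightarrow> set xs \<subseteq> V2 \<Longrightarrow> H.lprod xs \<in> V1"
      using H.nbhd_lprod[OF V1(1,2)] by metis
    obtain V3 where V3: "openin T V3" "\<one>\<^bsub>H\<^esub> \<in> V3" "\<And>x y. x \<in> V3 \<Longrightarrow> y \<in> V3 \<Longrightarrow> x \<otimes>\<^bsub>H\<^esub> y \<in> V2"
      using H.nbhd_mult[OF V2(1,2)] by blast
    obtain V4 where V4: "openin T V4" "\<one>\<^bsub>H\<^esub> \<in> V4"
      "\<And>w c. w \<in> V4 \<Longrightarrow> c \<in> C \<Longrightarrow> c \<otimes>\<^bsub>H\<^esub> w \<otimes>\<^bsub>H\<^esub> inv\<^bsub>H\<^esub> c \<in> V3"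
      using H.nbhd_conjugate_compact[OF V3(1,2) C(1)] by blast
    \<comment> \<open>\<open>V3\<close> receives the factor \<open>\<pi> p\<close>;
      \<open>V4\<close> and the symmetry of \<open>W\<close> take care of the conjugate of its
      inverse.\<close>
    obtain W where W: "openin T W" "\<one>\<^bsub>H\<^esub> \<in> W" "W \<subseteq> V3 \<inter> V4" "\<And>x. x \<in> W \<Longrightarrow> inv\<^bsub>H\<^esub> x \<in> W"
      using H.nbhd_symmetric[of "V3 \<inter> V4"] V3 V4 by blast
    obtain M :: nat where M: "\<And>f :: nat \<Rightarrow> 'c. (\<And>k. k \<le> M \<Longrightarrow> f k \<in> C) \<Longrightarrow>
        \<exists>k l. k < l \<and> l \<le> M \<and> inv\<^bsub>H\<^esub> (f k) \<otimes>\<^bsub>H\<^esub> f l \<in> W"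
      using H.pigeonhole_compact[OF W(1,2) C(1)] by blast
    define P where "P = {p \<in> U. \<pi> p \<in> W}"
    have "\<exists>k\<in>{1..M}. g [^]\<^bsub>G\<^esub> k \<in> P" if g: "g \<in> carrier G" "\<forall>k\<le>M. g [^]\<^bsub>G\<^esub> k \<in> U" for g
    proof -
      \<comment> \<open>The exponents \<open>0\<close> to \<open>M\<close> are compared. The
        quotient of two powers is the power with exponent \<open>l - k\<close>, which is at least
        \<open>1\<close> and at most \<open>M\<close>.\<close>
      obtain k l where kl: "k < l" "l \<le> M" "inv\<^bsub>H\<^esub> (\<pi> (g [^]\<^bsub>G\<^esub> k)) \<otimes>\<^bsub>H\<^esub> \<pi> (g [^]\<^bsub>G\<^esub> l) \<in> W"
        using M[of "\<lambda>k. \<pi> (g [^]\<^bsub>G\<^esub> k)"] C(2) g by blast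
      have "g [^]\<^bsub>G\<^esub> l = g [^]\<^bsub>G\<^esub> k \<otimes>\<^bsub>G\<^esub> g [^]\<^bsub>G\<^esub> (l - k)"
        using kl g by (simp add: G.nat_pow_mult)
      then have "\<pi> (g [^]\<^bsub>G\<^esub> (l - k)) \<in> W"
        using kl g by (simp add: H.inv_mult_cancel_left)
      moreover have "g [^]\<^bsub>G\<^esub> (l - k) \<in> U" using g kl by simp
      ultimately show ?thesis using kl by (intro bexI[of _ "l - k"]) (auto simp: P_def)
    qed
    then obtain N where N: "openin S N" "\<one>\<^bsub>G\<^esub> \<in> N" and
      Nc: "\<And>g h. g \<in> N \<Longrightarrow> h \<in> N \<Longrightarrow> \<exists>ps. length ps \<le> n \<and> set ps \<subseteq> P \<times> U \<and>
        G.comm g h = G.lprod (map (\<lambda>(p, x). G.comm p x) ps)"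
      using width[unfolded G.controlled_commutators_def, rule_format, of U P M] U
      by (auto simp: P_def)
    have in_V1: "\<pi> (G.comm g h) \<in> V1" if gh: "g \<in> N" "h \<in> N" for g h
    proof -
      from Nc[OF gh] obtain ps where ps: "length ps \<le> n" "set ps \<subseteq> P \<times> U"
        "G.comm g h = G.lprod (map (\<lambda>(p, x). G.comm p x) ps)" by blast
      have *: "G.comm p x \<in> carrier G \<and> \<pi> (G.comm p x) \<in> V2" if "(p, x) \<in> set ps" for p x
      proof -
        have px: "p \<in> P" "p \<in> U" "x \<in> U" "p \<in> carrier G" "x \<in> carrier G"
          using that ps(2) G.openin_carrier[OF U(1)] by (auto simp: P_def)
        have "\<pi> p \<in> W" "\<pi> x \<in> C" using px C(2) by (auto simp: P_def)
        then have "\<pi> p \<in> V3" "\<pi> x \<otimes>\<^bsub>H\<^esub> inv\<^bsub>H\<^esub> (\<pi> p) \<otimes>\<^bsub>H\<^esub> inv\<^bsub>H\<^esub> (\<pi> x) \<in> V3"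
          using W(3,4) by (auto intro!: V4(3))
        then have "\<pi> p \<otimes>\<^bsub>H\<^esub> (\<pi> x \<otimes>\<^bsub>H\<^esub> inv\<^bsub>H\<^esub> (\<pi> p) \<otimes>\<^bsub>H\<^esub> inv\<^bsub>H\<^esub> (\<pi> x)) \<in> V2" by (rule V3(3))
        then show ?thesis using px by (simp add: hom_comm H.comm_def H.m_assoc G.comm_closed)
      qed
      then have "set (map (\<lambda>(p, x). G.comm p x) ps) \<subseteq> carrier G" by auto
      from hom_lprod[OF this] have "\<pi> (G.comm g h) = H.lprod (map \<pi> (map (\<lambda>(p, x). G.comm p x) ps))"
        by (simp only: ps(3))
      also have "\<dots> \<in> V1" using ps(1) * by (intro V2(3)) auto
      finally show ?thesis .
    qed
    have cl: "a \<in> T closure_of (\<pi> ` N)" "b \<in> T closure_of (\<pi> ` N)"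
      using ab N by (auto simp: DG_def nbhds_def dest: openin_subset)
    have "H.comm a b \<in> T closure_of ((\<lambda>(x, y). H.comm x y) ` (\<pi> ` N \<times> \<pi> ` N))"
      by (rule H.closure_of_comm[OF cl])
    moreover have "(\<lambda>(x, y). H.comm x y) ` (\<pi> ` N \<times> \<pi> ` N) \<subseteq> V1"
    proof clarsimp
      fix g h assume gh: "g \<in> N" "h \<in> N"
      then show "H.comm (\<pi> g) (\<pi> h) \<in> V1"
        using in_V1[OF gh] G.openin_carrier[OF N(1)] by (simp add: hom_comm)
    qed
    ultimately have "H.comm a b \<in> T closure_of V1" by (rule closure_of_mono[THEN subsetD, rotated])
    then obtain v w where "v \<in> V1" "w \<in> V1" "H.comm a b = v \<otimes>\<^bsub>H\<^esub> w"
      by (rule H.closure_of_subset_mult[OF V1(1,2)])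
    then show ?thesis using V1(3) by simp
  qed
  have "a \<otimes>\<^bsub>H\<^esub> b = b \<otimes>\<^bsub>H\<^esub> a" if ab: "a \<in> ?D" "b \<in> ?D" for a b
  proof -
    have abH: "a \<in> carrier H" "b \<in> carrier H" using ab subgroup.subset[OF sub] by auto
    have "H.comm a b = \<one>\<^bsub>H\<^esub>"
    proof (rule ccontr)
      assume "H.comm a b \<noteq> \<one>\<^bsub>H\<^esub>"
      moreover have "\<one>\<^bsub>H\<^esub> \<in> topspace T" "H.comm a b \<in> topspace T"
        using abH by (simp_all add: H.topspace_eq H.comm_closed)
      ultimately obtain V1 V2 where "openin T V1" "openin T V2" "\<one>\<^bsub>H\<^esub> \<in> V1" "H.comm a b \<in> V2" "disjnt V1 V2"
        using T unfolding Hausdorff_space_def by metis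
      then show False using small[of V1 a b] ab by (auto simp: disjnt_iff)
    qed
    then show ?thesis using abH by (simp add: H.comm_eq_one_iff)
  qed
  then show ?thesis
    by (intro group.group_comm_groupI H.subgroup_imp_group[OF sub]) simp
qed

section \<open>Lie groups in a chart\<close>

text \<open>The chain rule and the uniqueness of derivatives turn an identity between maps near
  \<open>x\<close> into one between first derivatives. The group laws are differentiated in this
  way.\<close>

lemma (in C2_map) D1_eqI:
  assumes "c x \<in> S" "(c has_derivative c') (at x)" "(F has_derivative F') (at x)"
    and "open A" "x \<in> A" "\<And>y. y \<in> A \<Longrightarrow> f (c y) = F y"
  shows "D1 (c x) (c' u) = F' u"
proof -
  have "(F has_derivative (\<lambda>u. D1 (c x) (c' u))) (at x)"
    by (rule has_derivative_transform_within_open[OF has_derivative_compose_D1[OF assms(1,2)] assms(4,5,6)])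
  from has_derivative_unique[OF this assms(3)] show ?thesis by (rule fun_cong)
qed

lemma (in C2_map) tendsto_D1:
  assumes c: "(c \<longlongrightarrow> c0) F" and c0: "c0 \<in> S" and v: "(v \<longlongrightarrow> v0) F"
  shows "((\<lambda>t. D1 (c t) (v t)) \<longlongrightarrow> D1 c0 v0) F"
proof -
  have "continuous_on (S \<times> UNIV) (\<lambda>z. D1 (fst z) (snd z))"
    by (rule continuous_on_D1) (auto intro!: continuous_intros)
  moreover have "open (S \<times> (UNIV :: 'a set))" by (simp add: open_Times open_dom)
  ultimately have "isCont (\<lambda>z. D1 (fst z) (snd z)) (c0, v0)"
    using c0 by (simp add: continuous_on_eq_continuous_at)
  from isCont_tendsto_compose[OF this tendsto_Pair[OF c v]] show ?thesis by simp
qed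

lemma (in top_group) continuous_pow:
  "continuous_map X T f \<Longrightarrow> continuous_map X T (\<lambda>x. f x [^] (k::nat))"
  by (induction k) (simp_all add: continuous_mult one_in_topspace)

text \<open>Only the topology of a chart around the identity is recorded here, so that the
  coordinate domains \<open>DM\<close> and \<open>DI\<close> are known to be open before
  differentiability on them is assumed. The chart is not centered; the identity sits at
  \<open>e0\<close>.\<close>

locale chart_group = top_group G T
  for G :: "('a, 'r) monoid_scheme" (structure) and T :: "'a topology" +
  fixes U :: "'a set" and \<phi> :: "'a \<Rightarrow> 'e::euclidean_space" and \<sigma> :: "'e \<Rightarrow> 'a" and X :: "'e set"
  assumes open_U: "openin T U" and one_U: "\<one> \<in> U" and open_X: "open X"
    and phi_in: "g \<in> U \<Longrightarrow> \<phi> g \<in> X" and sigma_phi: "g \<in> U \<Longrightarrow> \<sigma> (\<phi> g) = g"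
    and sigma_in: "x \<in> X \<Longrightarrow> \<sigma> x \<in> U" and phi_sigma: "x \<in> X \<Longrightarrow> \<phi> (\<sigma> x) = x"
    and continuous_phi: "continuous_map (subtopology T U) euclidean \<phi>"
    and continuous_sigma: "continuous_map (top_of_set X) T \<sigma>"
begin

definition "e0 = \<phi> \<one>"
text \<open>The product takes a pair, so that it is a map on a single Euclidean space as
  \<open>Ck_on\<close> requires. Its values represent group products only on
  \<open>DM\<close>.\<close>

definition "mu = (\<lambda>(x, y). \<phi> (\<sigma> x \<otimes> \<sigma> y))"
definition "iota x = \<phi> (inv (\<sigma> x))"
definition "DM = {(x, y). x \<in> X \<and> y \<in> X \<and> \<sigma> x \<otimes> \<sigma> y \<in> U}"
definition "DI = {x \<in> X. inv (\<sigma> x) \<in> U}"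

lemma U_carrier: "g \<in> U \<Longrightarrow> g \<in> carrier G"
  using openin_carrier[OF open_U] .

lemma sigma_carrier: "x \<in> X \<Longrightarrow> \<sigma> x \<in> carrier G"
  by (simp add: sigma_in U_carrier)

lemma e0: "e0 \<in> X" "\<sigma> e0 = \<one>"
  by (simp_all add: e0_def phi_in sigma_phi one_U)

lemma DI_X: "x \<in> DI \<Longrightarrow> x \<in> X"
  by (simp add: DI_def)

lemma DM_X: "(x, y) \<in> DM \<Longrightarrow> x \<in> X" "(x, y) \<in> DM \<Longrightarrow> y \<in> X"
  by (simp_all add: DM_def)

lemma openin_phi_vimage:
  assumes "open W"
  shows "openin T {g \<in> U. \<phi> g \<in> W}"
proof -
  have "openin (subtopology T U) {g \<in> topspace (subtopology T U). \<phi> g \<in> W}"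
    using continuous_phi assms by (intro openin_continuous_map_preimage) auto
  moreover have "topspace (subtopology T U) = U"
    using openin_subset[OF open_U] by auto
  ultimately have "openin (subtopology T U) {g \<in> U. \<phi> g \<in> W}" by (simp only:)
  then show ?thesis by (rule openin_trans_full[OF _ open_U])
qed

lemma open_continuous_vimage:
  assumes "continuous_map (top_of_set A) T F" "open A" "openin T V"
  shows "open {x \<in> A. F x \<in> V}"
proof -
  have "openin (top_of_set A) {x \<in> topspace (top_of_set A). F x \<in> V}"
    using assms(1,3) by (rule openin_continuous_map_preimage)
  then show ?thesis using openin_open_trans[OF _ assms(2)] by simp
qed

lemma open_DM: "open DM"
proof -
  have "continuous_map (top_of_set (X \<times> X)) T (\<lambda>z. \<sigma> (fst z) \<otimes> \<sigma> (snd z))"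
  proof (intro continuous_mult)
    have "continuous_map (top_of_set (X \<times> X)) (top_of_set X) fst"
      "continuous_map (top_of_set (X \<times> X)) (top_of_set X) snd"
      by (auto simp: continuous_map_in_subtopology intro!: continuous_intros)
    from this[THEN continuous_map_compose, OF continuous_sigma]
    show "continuous_map (top_of_set (X \<times> X)) T (\<lambda>z. \<sigma> (fst z))"
      "continuous_map (top_of_set (X \<times> X)) T (\<lambda>z. \<sigma> (snd z))"
      by (simp_all add: o_def)
  qed
  from open_continuous_vimage[OF this open_Times[OF open_X open_X] open_U]
  have "open {z \<in> X \<times> X. \<sigma> (fst z) \<otimes> \<sigma> (snd z) \<in> U}" .
  moreover have "{z \<in> X \<times> X. \<sigma> (fst z) \<otimes> \<sigma> (snd z) \<in> U} = DM" by (auto simp: DM_def)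
  ultimately show ?thesis by (simp only:)
qed

lemma open_DI: "open DI"
  unfolding DI_def by (rule open_continuous_vimage[OF continuous_inv[OF continuous_sigma] open_X open_U])

lemma sigma_mu: "(x, y) \<in> DM \<Longrightarrow> \<sigma> (mu (x, y)) = \<sigma> x \<otimes> \<sigma> y"
  by (simp add: DM_def mu_def sigma_phi)

lemma sigma_iota: "x \<in> DI \<Longrightarrow> \<sigma> (iota x) = inv (\<sigma> x)"
  by (simp add: DI_def iota_def sigma_phi)

lemma iota_DI: "x \<in> DI \<Longrightarrow> iota x \<in> DI"
  by (simp add: DI_def iota_def sigma_phi phi_in sigma_carrier sigma_in)

lemma e0_DI: "e0 \<in> DI" and iota_e0: "iota e0 = e0"
  by (simp_all add: DI_def e0 one_U iota_def) (simp add: e0_def)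

lemma e0_DM: "x \<in> X \<Longrightarrow> (e0, x) \<in> DM" "x \<in> X \<Longrightarrow> (x, e0) \<in> DM"
  by (simp_all add: DM_def e0 sigma_in sigma_carrier)

lemma mu_e0: "x \<in> X \<Longrightarrow> mu (e0, x) = x" "x \<in> X \<Longrightarrow> mu (x, e0) = x"
  by (simp_all add: mu_def e0 phi_sigma sigma_carrier)

lemma iota_DM:
  assumes "x \<in> DI"
  shows "(iota x, x) \<in> DM" "(x, iota x) \<in> DM" "mu (iota x, x) = e0" "mu (x, iota x) = e0"
  using assms DI_X[OF iota_DI[OF assms]]
  by (simp_all add: DM_def mu_def DI_X sigma_iota sigma_carrier one_U e0_def)

lemma open_slice: "open {z. (x, z) \<in> DM}" "open {z. (z, x) \<in> DM}"
proof -
  have "open ((\<lambda>z. (x, z)) -` DM)" "open ((\<lambda>z. (z, x)) -` DM)"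
    by (intro open_vimage open_DM continuous_intros)+
  then show "open {z. (x, z) \<in> DM}" "open {z. (z, x) \<in> DM}" by (simp_all add: vimage_def)
qed

end

locale lie_chart = chart_group G T U \<phi> \<sigma> X
  for G :: "('a, 'r) monoid_scheme" (structure) and T U
    and \<phi> :: "'a \<Rightarrow> 'e::euclidean_space" and \<sigma> X +
  assumes C2_mu: "Ck_on 2 mu DM" and C2_iota: "Ck_on 2 iota DI"
begin

sublocale M: C2_map mu DM
  by unfold_locales (rule open_DM C2_mu)+

sublocale I: C2_map iota DI
  by unfold_locales (rule open_DI C2_iota)+

lemma slice_derivs:
  "((\<lambda>z. (x, z)) has_derivative (\<lambda>v. (0, v))) (at y)"
  "((\<lambda>z. (z, x)) has_derivative (\<lambda>v. (v, 0))) (at y)"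
  by (auto intro!: derivative_eq_intros)

lemma D1_e0_left: "x \<in> X \<Longrightarrow> M.D1 (e0, x) (0, v) = v"
  by (rule M.D1_eqI[OF _ slice_derivs(1) has_derivative_ident open_X]) (simp_all add: e0_DM mu_e0)

lemma D1_e0_right: "x \<in> X \<Longrightarrow> M.D1 (x, e0) (v, 0) = v"
  by (rule M.D1_eqI[OF _ slice_derivs(2) has_derivative_ident open_X]) (simp_all add: e0_DM mu_e0)

lemma D1_split: "z \<in> DM \<Longrightarrow> M.D1 z (u, v) = M.D1 z (u, 0) + M.D1 z (0, v)"
  using linear_add[OF M.linear_D1[of z], of "(u, 0)" "(0, v)"] by simp

lemma D1_e0: "M.D1 (e0, e0) (u, v) = u + v"
  using D1_split[OF e0_DM(1)[OF e0(1)], of u v] by (simp add: D1_e0_left D1_e0_right e0)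

lemma D1_iota:
  assumes "x \<in> DI"
  shows "M.D1 (x, iota x) (v, I.D1 x v) = 0"
proof (rule M.D1_eqI[where c = "\<lambda>x. (x, iota x)" and F = "\<lambda>_. e0" and x = x
      and c' = "\<lambda>v. (v, I.D1 x v)" and F' = "\<lambda>_. 0" and u = v and A = DI])
  show "((\<lambda>x. (x, iota x)) has_derivative (\<lambda>v. (v, I.D1 x v))) (at x)"
    by (intro has_derivative_Pair has_derivative_ident I.has_derivative_D1 assms)
qed (use assms open_DI in \<open>auto simp: iota_DM\<close>)

lemma I_D1_e0: "I.D1 e0 v = - v"
  using D1_iota[OF e0_DI, of v] by (simp add: iota_e0 D1_e0 eq_neg_iff_add_eq_0 add.commute)

section \<open>The Maurer-Cartan form and local homomorphisms\<close>

text \<open>This is the Lie bracket of left-invariant vector fields in coordinates: the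
  antisymmetrized mixed second derivative of the product at the identity.\<close>

definition "bracket u v = M.D2 (e0, e0) (u, 0) (0, v) - M.D2 (e0, e0) (v, 0) (0, u)"

text \<open>The derivative at \<open>x\<close> of left translation by the inverse of
  \<open>x\<close>, with values in the tangent space at the identity.\<close>

definition "maurer_cartan x v = M.D1 (iota x, x) (0, v)"
definition "maurer_cartan_deriv x u v = M.D2 (iota x, x) (I.D1 x u, u) (0, v)"

lemma linear_Pair0: "linear (\<lambda>v. (0 :: 'e, v :: 'e))" "linear (\<lambda>v. (v :: 'e, 0 :: 'e))"
  by (auto intro!: linearI)

lemma linear_maurer_cartan: "x \<in> DI \<Longrightarrow> linear (maurer_cartan x)"
  using linear_compose[OF linear_Pair0(1) M.linear_D1[OF iota_DM(1)]]
  by (simp add: maurer_cartan_def[abs_def] o_def)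

lemma linear_maurer_cartan_deriv_right: "x \<in> DI \<Longrightarrow> linear (maurer_cartan_deriv x u)"
  using linear_compose[OF linear_Pair0(1) M.linear_D2_right[OF iota_DM(1)]]
  by (simp add: maurer_cartan_deriv_def[abs_def] o_def)

lemma iota_graph_deriv:
  assumes "x \<in> DI"
  shows "((\<lambda>x. (iota x, x)) has_derivative (\<lambda>u. (I.D1 x u, u))) (at x)"
  by (intro has_derivative_Pair has_derivative_ident I.has_derivative_D1 assms)

lemma has_derivative_maurer_cartan:
  assumes "x \<in> DI"
  shows "((\<lambda>x. maurer_cartan x v) has_derivative (\<lambda>u. maurer_cartan_deriv x u v)) (at x)"
  using M.has_derivative_D1_compose[OF _ iota_graph_deriv[OF assms] has_derivative_const, of "(0, v)"]
    linear_0[OF M.linear_D1[OF iota_DM(1)[OF assms]]]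
  by (simp add: iota_DM assms maurer_cartan_def maurer_cartan_deriv_def zero_prod_def[symmetric])

lemma continuous_on_maurer_cartan_deriv: "continuous_on DI (\<lambda>x. maurer_cartan_deriv x u v)"
  unfolding maurer_cartan_deriv_def
  by (rule M.continuous_on_D2)
    (auto intro!: continuous_intros I.continuous_on_dom I.continuous_on_D1_const iota_DM)

lemma maurer_cartan_e0: "maurer_cartan e0 v = v"
  by (simp add: maurer_cartan_def iota_e0 D1_e0)

text \<open>Left translation by \<open>x\<close> followed by left translation by the inverse of
  \<open>x y\<close> is left translation by the inverse of \<open>y\<close>. The claim is the
  derivative of this identity at \<open>y\<close>.\<close>

lemma maurer_cartan_left_invariant:
  assumes xy: "(x, y) \<in> DM" and y: "y \<in> DI" and xyI: "mu (x, y) \<in> DI"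
  shows "maurer_cartan (mu (x, y)) (M.D1 (x, y) (0, v)) = maurer_cartan y v"
  unfolding maurer_cartan_def
proof (rule M.D1_eqI[where c = "\<lambda>z. (iota (mu (x, y)), mu (x, z))" and x = y
      and c' = "\<lambda>v. (0, M.D1 (x, y) (0, v))" and u = v
      and F = "\<lambda>z. mu (iota y, z)" and F' = "\<lambda>v. M.D1 (iota y, y) (0, v)" and A = "{z. (x, z) \<in> DM}"])
  show "((\<lambda>z. (iota (mu (x, y)), mu (x, z))) has_derivative (\<lambda>v. (0, M.D1 (x, y) (0, v)))) (at y)"
    by (intro has_derivative_Pair has_derivative_const M.has_derivative_compose_D1[OF xy slice_derivs(1)])
  show "((\<lambda>z. mu (iota y, z)) has_derivative (\<lambda>v. M.D1 (iota y, y) (0, v))) (at y)"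
    by (rule M.has_derivative_compose_D1[OF iota_DM(1)[OF y] slice_derivs(1)])
  fix z assume z: "z \<in> {z. (x, z) \<in> DM}"
  then have "\<sigma> (iota (mu (x, y))) \<otimes> \<sigma> (mu (x, z)) = inv (\<sigma> x \<otimes> \<sigma> y) \<otimes> (\<sigma> x \<otimes> \<sigma> z)"
    using xy xyI by (simp add: sigma_iota sigma_mu)
  also have "\<dots> = \<sigma> (iota y) \<otimes> \<sigma> z"
    using DM_X[of x z] DM_X[OF xy] z y
    by (simp add: sigma_iota sigma_carrier inv_mult_group m_assoc inv_mult_cancel_left)
  finally show "mu (iota (mu (x, y)), mu (x, z)) = mu (iota y, z)"
    by (simp add: mu_def)
qed (use xy xyI open_slice in \<open>auto simp: iota_DM\<close>)

text \<open>Moving the second entry contributes nothing, because left translation by the identity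
  has a constant derivative. The sign comes from the derivative of the inversion in the first
  entry.\<close>

lemma maurer_cartan_deriv_e0: "maurer_cartan_deriv e0 u v = - M.D2 (e0, e0) (u, 0) (0, v)"
proof -
  have z: "(e0, e0) \<in> DM" by (simp add: e0_DM e0)
  have "((\<lambda>y. M.D1 (e0, y) (0, v)) has_derivative (\<lambda>u. M.D2 (e0, e0) (0, u) (0, v))) (at e0)"
    using M.has_derivative_D1_compose[OF z slice_derivs(1) has_derivative_const, of "(0, v)"]
      linear_0[OF M.linear_D1[OF z]] by (simp add: zero_prod_def[symmetric])
  moreover have "((\<lambda>y. M.D1 (e0, y) (0, v)) has_derivative (\<lambda>u. 0)) (at e0)"
    by (rule has_derivative_transform_within_open[OF has_derivative_const[of v] open_X e0(1)])
      (simp add: D1_e0_left)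
  ultimately have 0: "M.D2 (e0, e0) (0, u) (0, v) = 0" for u
    using has_derivative_unique by (metis (no_types))
  have "maurer_cartan_deriv e0 u v = M.D2 (e0, e0) (- u, 0) (0, v) + M.D2 (e0, e0) (0, u) (0, v)"
    using linear_add[OF M.linear_D2_left[OF z, of "(0, v)"], of "(- u, 0)" "(0, u)"]
    by (simp add: maurer_cartan_deriv_def iota_e0 I_D1_e0)
  also have "\<dots> = - M.D2 (e0, e0) (u, 0) (0, v)"
    using linear_neg[OF M.linear_D2_left[OF z, of "(0, v)"], of "(u, 0)"] by (simp add: 0)
  finally show ?thesis .
qed

text \<open>The Maurer-Cartan equation. Left invariance carries the derivative from \<open>x\<close>
  to the identity up to a second derivative of a left translation; that term is symmetric in
  \<open>u\<close> and \<open>v\<close> and cancels in the difference.\<close>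

lemma structure_equation:
  assumes x: "x \<in> DI"
  shows "maurer_cartan_deriv x u v - maurer_cartan_deriv x v u =
    - bracket (M.D1 (iota x, x) (0, u)) (M.D1 (iota x, x) (0, v))"
proof -
  let ?t = "\<lambda>u. M.D1 (iota x, x) (0, u)"
  have z: "(iota x, x) \<in> DM" by (rule iota_DM(1)[OF x])
  \<comment> \<open>A neighborhood of \<open>x\<close> on which left invariance under
    \<open>iota x\<close> applies, so that the identity may be differentiated at
    \<open>x\<close>.\<close>
  let ?A = "DI \<inter> ({z. (iota x, z) \<in> DM} \<inter> (\<lambda>z. mu (iota x, z)) -` DI)"
  have "continuous_on {z. (iota x, z) \<in> DM} (\<lambda>z. mu (iota x, z))"
    by (rule continuous_on_compose2[OF M.continuous_on_dom]) (auto intro!: continuous_intros)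
  then have A: "open ?A"
    by (intro open_Int open_DI continuous_open_preimage open_slice)
  have xA: "x \<in> ?A" using x z by (simp add: iota_DM e0_DI)
  have key: "maurer_cartan_deriv x u v = maurer_cartan_deriv e0 (?t u) (?t v) + M.D2 (iota x, x) (0, u) (0, v)" for u v
  proof -
    have w: "((\<lambda>z. M.D1 (iota x, z) (0, v)) has_derivative (\<lambda>u. M.D2 (iota x, x) (0, u) (0, v))) (at x)"
      using M.has_derivative_D1_compose[OF z slice_derivs(1) has_derivative_const, of "(0, v)"]
        linear_0[OF M.linear_D1[OF z]] by (simp add: zero_prod_def[symmetric])
    have "((\<lambda>z. maurer_cartan (mu (iota x, z)) (M.D1 (iota x, z) (0, v))) has_derivative
        (\<lambda>u. maurer_cartan_deriv (mu (iota x, x)) (?t u) (?t v) +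
          maurer_cartan (mu (iota x, x)) (M.D2 (iota x, x) (0, u) (0, v)))) (at x)"
      by (rule has_derivative_linear_family[OF open_DI _ linear_maurer_cartan
            linear_maurer_cartan_deriv_right has_derivative_maurer_cartan
            M.has_derivative_compose_D1[OF z slice_derivs(1)] w])
        (use xA in auto)
    then have "((\<lambda>z. maurer_cartan z v) has_derivative
        (\<lambda>u. maurer_cartan_deriv (mu (iota x, x)) (?t u) (?t v) +
          maurer_cartan (mu (iota x, x)) (M.D2 (iota x, x) (0, u) (0, v)))) (at x)"
      by (rule has_derivative_transform_within_open[OF _ A xA]) (simp add: maurer_cartan_left_invariant)
    from fun_cong[OF has_derivative_unique[OF has_derivative_maurer_cartan[OF x] this], of u]
    show ?thesis by (simp add: iota_DM[OF x] maurer_cartan_e0)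
  qed
  show ?thesis
    unfolding key[of u v] key[of v u] using M.D2_commute[OF z, of "(0, u)" "(0, v)"]
    by (simp add: maurer_cartan_deriv_e0 bracket_def)
qed

text \<open>\<open>N\<close> is obtained before \<open>L\<close>: later \<open>L\<close> is built
  from elements of \<open>P\<close> in a neighborhood that is itself chosen inside \<open>N\<close>.
  This is possible because the form is integrated on a ball that depends only on the chart.\<close>

lemma local_homomorphism:
  obtains N where "openin T N" "\<one> \<in> N" "N \<subseteq> U"
    "\<forall>L. linear L \<longrightarrow> (\<forall>u v. L (bracket u v) = 0) \<longrightarrow>
      (\<exists>f :: 'e \<Rightarrow> 'e. f e0 = 0 \<and> (f has_derivative L) (at e0) \<and>
        (\<forall>g\<in>N. \<forall>h\<in>N. g \<otimes> h \<in> U \<and> f (\<phi> (g \<otimes> h)) = f (\<phi> g) + f (\<phi> h)))"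
proof -
  obtain r where r: "r > 0" "ball e0 r \<subseteq> DI"
    using open_DI e0_DI by (meson open_contains_ball)
  have "open (DM \<inter> mu -` ball e0 r)"
    by (intro continuous_open_preimage M.continuous_on_dom open_DM open_ball)
  moreover have "(e0, e0) \<in> DM \<inter> mu -` ball e0 r"
    using r by (simp add: e0_DM mu_e0 e0)
  ultimately obtain A B where AB: "open A" "open B" "e0 \<in> A" "e0 \<in> B" "A \<times> B \<subseteq> DM \<inter> mu -` ball e0 r"
    by (rule open_prod_elim) auto
  then have "open (A \<inter> B \<inter> ball e0 r)" "e0 \<in> A \<inter> B \<inter> ball e0 r" using r by auto
  then obtain d where d: "d > 0" "ball e0 d \<subseteq> A \<inter> B \<inter> ball e0 r"
    by (meson open_contains_ball)
  have dom: "(x, y) \<in> DM" "mu (x, y) \<in> ball e0 r" if "x \<in> ball e0 d" "y \<in> ball e0 d" for x y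
  proof -
    have "(x, y) \<in> DM \<inter> mu -` ball e0 r" using AB(5) d(2) that by blast
    then show "(x, y) \<in> DM" "mu (x, y) \<in> ball e0 r" by auto
  qed
  define N where "N = {g \<in> U. \<phi> g \<in> ball e0 d}"
  have "\<exists>f. f e0 = 0 \<and> (f has_derivative L) (at e0) \<and>
        (\<forall>g\<in>N. \<forall>h\<in>N. g \<otimes> h \<in> U \<and> f (\<phi> (g \<otimes> h)) = f (\<phi> g) + f (\<phi> h))"
    if L: "linear L" and Lbr: "\<And>u v. L (bracket u v) = 0" for L :: "'e \<Rightarrow> 'e"
  proof -
    have bL: "bounded_linear L" using L by (simp add: linear_conv_bounded_linear)
    obtain f where f: "f e0 = 0" "\<And>x. x \<in> ball e0 r \<Longrightarrow> (f has_derivative (\<lambda>v. L (maurer_cartan x v))) (at x)"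
    proof (rule primitive_of_closed_form[of r e0 "\<lambda>x v. L (maurer_cartan x v)" "\<lambda>x u v. L (maurer_cartan_deriv x u v)"])
      show "linear (\<lambda>v. L (maurer_cartan x v))" if "x \<in> ball e0 r" for x
        using linear_compose[OF linear_maurer_cartan L, of x] r that by (auto simp: o_def)
      show "((\<lambda>x. L (maurer_cartan x v)) has_derivative (\<lambda>u. L (maurer_cartan_deriv x u v))) (at x)" if "x \<in> ball e0 r" for x v
        using bounded_linear.has_derivative[OF bL has_derivative_maurer_cartan] r that by auto
      show "continuous_on (ball e0 r) (\<lambda>x. L (maurer_cartan_deriv x u v))" for u v
        by (rule bounded_linear.continuous_on[OF bL continuous_on_subset[OF continuous_on_maurer_cartan_deriv r(2)]])
      show "L (maurer_cartan_deriv x u v) = L (maurer_cartan_deriv x v u)" if "x \<in> ball e0 r" for x u v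
      proof -
        have "L (maurer_cartan_deriv x u v) - L (maurer_cartan_deriv x v u) =
            L (- bracket (M.D1 (iota x, x) (0, u)) (M.D1 (iota x, x) (0, v)))"
          using structure_equation[of x u v] r that by (auto simp: linear_diff[OF L, symmetric])
        also have "\<dots> = 0" by (simp add: linear_neg[OF L] Lbr)
        finally show ?thesis by simp
      qed
    qed (use r in auto)
    have fL: "(f has_derivative L) (at e0)"
      using f(2)[of e0] r by (simp add: maurer_cartan_e0)
    have add: "f (mu (x, y)) = f x + f y" if x: "x \<in> ball e0 d" and y: "y \<in> ball e0 d" for x y
    proof -
      \<comment> \<open>Left invariance makes the derivative in \<open>y\<close> vanish on the ball;
        evaluating at \<open>e0\<close> shows that the constant is \<open>f x\<close>.\<close>
      have "\<exists>c. \<forall>y\<in>ball e0 d. f (mu (x, y)) - f y = c"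
      proof (rule has_derivative_zero_constant)
        fix y assume y: "y \<in> ball e0 d"
        have yr: "y \<in> ball e0 r" "y \<in> DI" "mu (x, y) \<in> DI"
          using y d r dom(2)[OF x y] by auto
        have "((\<lambda>y. f (mu (x, y)) - f y) has_derivative
            (\<lambda>v. L (maurer_cartan (mu (x, y)) (M.D1 (x, y) (0, v))) - L (maurer_cartan y v))) (at y)"
          by (intro has_derivative_diff f(2)[OF yr(1)]
              has_derivative_compose[OF M.has_derivative_compose_D1[OF dom(1)[OF x y] slice_derivs(1)] f(2)]
              dom(2) x y)
        then show "((\<lambda>y. f (mu (x, y)) - f y) has_derivative (\<lambda>v. 0)) (at y within ball e0 d)"
          using maurer_cartan_left_invariant[OF dom(1)[OF x y] yr(2,3)] by (simp add: has_derivative_at_withinI)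
      qed simp
      then obtain c where c: "\<And>y. y \<in> ball e0 d \<Longrightarrow> f (mu (x, y)) - f y = c" by blast
      have "x \<in> X" using x d(2) r(2) DI_X by blast
      then have "c = f x" using c[of e0] d(1) by (simp add: mu_e0 f(1))
      with c[OF y] show ?thesis by (simp add: algebra_simps)
    qed
    have "g \<otimes> h \<in> U \<and> f (\<phi> (g \<otimes> h)) = f (\<phi> g) + f (\<phi> h)" if "g \<in> N" "h \<in> N" for g h
    proof -
      have gh: "g \<in> U" "h \<in> U" "\<phi> g \<in> ball e0 d" "\<phi> h \<in> ball e0 d" using that by (auto simp: N_def)
      then show ?thesis using dom(1)[OF gh(3,4)] add[OF gh(3,4)]
        by (simp add: DM_def mu_def sigma_phi)
    qed
    with f(1) fL show ?thesis by blast
  qed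
  note main = this
  have "openin T N" unfolding N_def by (rule openin_phi_vimage[OF open_ball])
  moreover have "\<one> \<in> N" "N \<subseteq> U" using d one_U by (auto simp: N_def e0_def)
  ultimately show thesis by (rule that) (intro allI impI main, simp_all)
qed

section \<open>The derivative of a commutator in its second entry\<close>

text \<open>The derivatives at the identity of left and right translation by \<open>p\<close>,
  subtracted. Carried back to the identity by right translation with the inverse of
  \<open>p\<close>, the difference becomes \<open>comm_deriv p\<close>, which is
  \<open>Ad p - 1\<close> in coordinates.\<close>

definition "conj_defect p v = M.D1 (p, e0) (0, v) - M.D1 (e0, p) (v, 0)"
definition "comm_deriv p v = M.D1 (p, iota p) (conj_defect p v, 0)"

lemma has_derivative_comm:
  assumes p: "p \<in> DI"
  shows "((\<lambda>y. \<phi> (comm (\<sigma> p) (\<sigma> y))) has_derivative comm_deriv p) (at e0)"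
proof -
  have pX: "p \<in> X" by (rule DI_X[OF p])
  let ?A = "{y. (p, y) \<in> DM} \<inter> ({y. (y, p) \<in> DM} \<inter> (\<lambda>y. mu (y, p)) -` DI)"
  have "continuous_on {y. (y, p) \<in> DM} (\<lambda>y. mu (y, p))"
    by (rule continuous_on_compose2[OF M.continuous_on_dom]) (auto intro!: continuous_intros)
  then have A: "open ?A"
    by (intro open_Int open_DI continuous_open_preimage open_slice)
  have eA: "e0 \<in> ?A" using p pX by (simp add: e0_DM mu_e0)
  let ?b = "\<lambda>v. M.D1 (e0, p) (v, 0)" and ?a = "\<lambda>v. M.D1 (p, e0) (0, v)"
  have 1: "((\<lambda>y. mu (p, y)) has_derivative ?a) (at e0)"
    by (rule M.has_derivative_compose_D1[OF e0_DM(2)[OF pX] slice_derivs(1)])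
  have 2: "((\<lambda>y. mu (y, p)) has_derivative ?b) (at e0)"
    by (rule M.has_derivative_compose_D1[OF e0_DM(1)[OF pX] slice_derivs(2)])
  have 3: "((\<lambda>y. iota (mu (y, p))) has_derivative (\<lambda>v. I.D1 (mu (e0, p)) (?b v))) (at e0)"
    by (rule I.has_derivative_compose_D1[OF _ 2]) (simp add: mu_e0 p pX)
  have "((\<lambda>y. mu (mu (p, y), iota (mu (y, p)))) has_derivative
      (\<lambda>v. M.D1 (mu (p, e0), iota (mu (e0, p))) (?a v, I.D1 (mu (e0, p)) (?b v)))) (at e0)"
    by (rule M.has_derivative_compose_D1[OF _ has_derivative_Pair[OF 1 3]]) (simp add: mu_e0 p pX iota_DM)
  then have D: "((\<lambda>y. mu (mu (p, y), iota (mu (y, p)))) has_derivative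
      (\<lambda>v. M.D1 (p, iota p) (?a v, I.D1 p (?b v)))) (at e0)"
    by (simp add: mu_e0 pX)
  \<comment> \<open>By \<open>D1_iota\<close> the subtracted vector is zero. This removes the
    derivative of the inversion and leaves the difference of the two translations.\<close>
  have "M.D1 (p, iota p) (?a v, I.D1 p (?b v)) = comm_deriv p v" for v
    using linear_diff[OF M.linear_D1[OF iota_DM(2)[OF p]], of "(?a v, I.D1 p (?b v))" "(?b v, I.D1 p (?b v))"]
    by (simp add: D1_iota[OF p] comm_deriv_def conj_defect_def)
  with D have D': "((\<lambda>y. mu (mu (p, y), iota (mu (y, p)))) has_derivative comm_deriv p) (at e0)"
    by simp
  show ?thesis
  proof (rule has_derivative_transform_within_open[OF D' A eA])
    fix y assume y: "y \<in> ?A"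
    then have yX: "y \<in> X" using DM_X by blast
    have "\<sigma> (mu (p, y)) \<otimes> \<sigma> (iota (mu (y, p))) = (\<sigma> p \<otimes> \<sigma> y) \<otimes> inv (\<sigma> y \<otimes> \<sigma> p)"
      using y by (simp add: sigma_mu sigma_iota)
    also have "\<dots> = comm (\<sigma> p) (\<sigma> y)"
      using pX yX by (simp add: comm_def inv_mult_group m_assoc sigma_carrier)
    finally show "mu (mu (p, y), iota (mu (y, p))) = \<phi> (comm (\<sigma> p) (\<sigma> y))"
      by (simp add: mu_def)
  qed
qed

lemma linear_comm_deriv:
  assumes "p \<in> DI"
  shows "linear (comm_deriv p)"
  using has_derivative_linear[OF has_derivative_comm[OF assms]] .

text \<open>The derivative of \<open>Ad - 1\<close> at the identity is the bracket. Since
  \<open>conj_defect\<close> vanishes at \<open>e0\<close>, only this inner factor is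
  differentiated; the outer right translation enters through its limit, the identity, so two
  derivatives of the product suffice.\<close>

lemma comm_deriv_tendsto:
  fixes c :: "real \<Rightarrow> 'e"
  assumes c0: "c 0 = e0" and c: "(c has_derivative (\<lambda>t. t *\<^sub>R w)) (at 0)"
  shows "((\<lambda>t. comm_deriv (c t) v /\<^sub>R t) \<longlongrightarrow> bracket w v) (at 0)"
proof -
  have z: "(e0, e0) \<in> DM" by (simp add: e0_DM e0)
  have cc: "(c \<longlongrightarrow> e0) (at 0)"
    using has_derivative_continuous[OF c] by (simp add: continuous_within c0)
  have ev: "\<forall>\<^sub>F t in at 0. c t \<in> DI"
    using topological_tendstoD[OF cc open_DI e0_DI] .
  have ct: "((\<lambda>t. conj_defect (c t) v /\<^sub>R t) \<longlongrightarrow> bracket w v) (at 0)"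
  proof -
    have 1: "((\<lambda>t. (c t, e0)) has_derivative (\<lambda>t. (t *\<^sub>R w, 0))) (at 0)"
      by (intro has_derivative_Pair c has_derivative_const)
    have 2: "((\<lambda>t. (e0, c t)) has_derivative (\<lambda>t. (0, t *\<^sub>R w))) (at 0)"
      by (intro has_derivative_Pair c has_derivative_const)
    have zc: "(c 0, e0) \<in> DM" "(e0, c 0) \<in> DM" by (simp_all add: c0 z)
    have D0: "M.D1 (e0, e0) 0 = 0" by (rule linear_0[OF M.linear_D1[OF z]])
    have a: "((\<lambda>t. M.D1 (c t, e0) (0, v)) has_derivative (\<lambda>t. M.D2 (e0, e0) (t *\<^sub>R w, 0) (0, v))) (at 0)"
      using M.has_derivative_D1_compose[OF zc(1) 1 has_derivative_const, of "(0, v)"]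
      by (simp only: c0 D0 add_0_right)
    have b: "((\<lambda>t. M.D1 (e0, c t) (v, 0)) has_derivative (\<lambda>t. M.D2 (e0, e0) (0, t *\<^sub>R w) (v, 0))) (at 0)"
      using M.has_derivative_D1_compose[OF zc(2) 2 has_derivative_const, of "(v, 0)"]
      by (simp only: c0 D0 add_0_right)
    have s: "M.D2 (e0, e0) (t *\<^sub>R w, 0) (0, v) - M.D2 (e0, e0) (0, t *\<^sub>R w) (v, 0) = t *\<^sub>R bracket w v" for t
    proof -
      have "M.D2 (e0, e0) (t *\<^sub>R w, 0) (0, v) = t *\<^sub>R M.D2 (e0, e0) (w, 0) (0, v)"
        using linear_scale[OF M.linear_D2_left[OF z, of "(0, v)"], of t "(w, 0)"] by simp
      moreover have "M.D2 (e0, e0) (0, t *\<^sub>R w) (v, 0) = t *\<^sub>R M.D2 (e0, e0) (0, w) (v, 0)"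
        using linear_scale[OF M.linear_D2_left[OF z, of "(v, 0)"], of t "(0, w)"] by simp
      \<comment> \<open>Symmetry of the second derivative turns the term from right translation into
        the second half of \<open>bracket\<close>.\<close>
      moreover have "M.D2 (e0, e0) (0, w) (v, 0) = M.D2 (e0, e0) (v, 0) (0, w)"
        by (rule M.D2_commute[OF z])
      ultimately show ?thesis by (simp only: bracket_def scaleR_diff_right)
    qed
    have "((\<lambda>t. conj_defect (c t) v) has_derivative (\<lambda>t. t *\<^sub>R bracket w v)) (at 0)"
      using has_derivative_diff[OF a b] unfolding s conj_defect_def .
    then have "((\<lambda>t. norm (conj_defect (c t) v - conj_defect (c 0) v - (t - 0) *\<^sub>R bracket w v) / norm (t - 0)) \<longlongrightarrow> 0) (at 0)"
      unfolding has_derivative_iff_norm by (rule conjunct2)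
    moreover have N0: "conj_defect (c 0) v = 0" by (simp add: c0 conj_defect_def D1_e0)
    ultimately have "((\<lambda>t. norm (conj_defect (c t) v - t *\<^sub>R bracket w v) / norm t) \<longlongrightarrow> 0) (at 0)"
      by (simp only: diff_0_right)
    then have "((\<lambda>t. dist (conj_defect (c t) v /\<^sub>R t) (bracket w v)) \<longlongrightarrow> 0) (at 0)"
    proof (rule Lim_transform_eventually)
      have "norm (conj_defect (c t) v - t *\<^sub>R bracket w v) / norm t = dist (conj_defect (c t) v /\<^sub>R t) (bracket w v)" if "t \<noteq> 0" for t
      proof -
        have "dist (conj_defect (c t) v /\<^sub>R t) (bracket w v) = norm ((conj_defect (c t) v - t *\<^sub>R bracket w v) /\<^sub>R t)"
          using that by (simp add: dist_norm scaleR_diff_right)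
        then show ?thesis by (simp add: divide_inverse_commute)
      qed
      then show "\<forall>\<^sub>F t in at 0. norm (conj_defect (c t) v - t *\<^sub>R bracket w v) / norm t = dist (conj_defect (c t) v /\<^sub>R t) (bracket w v)"
        unfolding eventually_at_filter by simp
    qed
    then show ?thesis by (rule iffD2[OF tendsto_dist_iff])
  qed
  have ic: "((\<lambda>t. iota (c t)) \<longlongrightarrow> e0) (at 0)"
    using isCont_tendsto_compose[OF has_derivative_continuous[OF I.has_derivative_D1[OF e0_DI]] cc]
    by (simp add: iota_e0)
  have "((\<lambda>t. M.D1 (c t, iota (c t)) (conj_defect (c t) v /\<^sub>R t, 0)) \<longlongrightarrow> M.D1 (e0, e0) (bracket w v, 0)) (at 0)"
    by (rule M.tendsto_D1[OF tendsto_Pair[OF cc ic] z tendsto_Pair[OF ct tendsto_const]])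
  then have "((\<lambda>t. M.D1 (c t, iota (c t)) (conj_defect (c t) v /\<^sub>R t, 0)) \<longlongrightarrow> bracket w v) (at 0)"
    by (simp add: D1_e0)
  then show ?thesis
  proof (rule Lim_transform_eventually)
    show "\<forall>\<^sub>F t in at 0. M.D1 (c t, iota (c t)) (conj_defect (c t) v /\<^sub>R t, 0) = comm_deriv (c t) v /\<^sub>R t"
      using ev
    proof eventually_elim
      case (elim t)
      show ?case
        using linear_scale[OF M.linear_D1[OF iota_DM(2)[OF elim]], of "inverse t" "(conj_defect (c t) v, 0)"]
        by (simp add: comm_deriv_def)
    qed
  qed
qed

lemma pow_curve:
  "\<forall>\<^sub>F t in nhds 0. \<sigma> (e0 + t *\<^sub>R u) [^] k \<in> V" if "openin T V" "\<one> \<in> V" for k :: nat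
proof -
  let ?J = "{t :: real. e0 + t *\<^sub>R u \<in> X}"
  have J: "open ?J"
    using open_vimage[OF open_X, of "\<lambda>t :: real. e0 + t *\<^sub>R u"] by (simp add: vimage_def continuous_intros)
  have "continuous_map (top_of_set ?J) (top_of_set X) (\<lambda>t. e0 + t *\<^sub>R u)"
    by (auto simp: continuous_map_in_subtopology intro!: continuous_intros)
  from continuous_map_compose[OF this continuous_sigma]
  have "continuous_map (top_of_set ?J) T (\<lambda>t. \<sigma> (e0 + t *\<^sub>R u) [^] k)"
    by (intro continuous_pow) (simp add: o_def)
  from open_continuous_vimage[OF this J that(1)]
  show ?thesis unfolding eventually_nhds
    by (intro exI conjI) (use that(2) e0 in auto)
qed

text \<open>The derivative of the product at the identity is addition, so to first order a
  \<open>k\<close>-th power multiplies the velocity by \<open>k\<close>, although the curve need not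
  be a one-parameter subgroup.\<close>

lemma pow_curve_derivative:
  "((\<lambda>t :: real. \<phi> (\<sigma> (e0 + t *\<^sub>R u) [^] k)) has_derivative (\<lambda>t. t *\<^sub>R (real k *\<^sub>R u))) (at 0)"
proof (induction k)
  case 0
  show ?case by simp
next
  case (Suc k)
  have z: "(e0, e0) \<in> DM" by (simp add: e0_DM e0)
  let ?c = "\<lambda>t :: real. \<phi> (\<sigma> (e0 + t *\<^sub>R u) [^] k)"
  have "\<phi> (\<sigma> e0 [^] k) = e0" by (simp add: e0) (simp add: e0_def)
  note c0 = scaleR_zero_left add_0_right this
  have "((\<lambda>t :: real. e0 + t *\<^sub>R u) has_derivative (\<lambda>t. t *\<^sub>R u)) (at 0)"
    by (auto intro!: derivative_eq_intros)
  note P = has_derivative_Pair[OF Suc.IH this]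
  have "(?c 0, e0 + 0 *\<^sub>R u) \<in> DM" using z by (simp only: c0)
  from M.has_derivative_compose_D1[OF this P]
  have "((\<lambda>t. mu (?c t, e0 + t *\<^sub>R u)) has_derivative (\<lambda>t. t *\<^sub>R (real k *\<^sub>R u) + t *\<^sub>R u)) (at 0)"
    by (simp only: c0 D1_e0)
  also have "(\<lambda>t. t *\<^sub>R (real k *\<^sub>R u) + t *\<^sub>R u) = (\<lambda>t. t *\<^sub>R (real (Suc k) *\<^sub>R u))"
    by (simp add: scaleR_add_left scaleR_add_right add.commute distrib_left)
  finally have D: "((\<lambda>t. mu (?c t, e0 + t *\<^sub>R u)) has_derivative (\<lambda>t. t *\<^sub>R (real (Suc k) *\<^sub>R u))) (at 0)" .
  obtain A where A: "open A" "0 \<in> A" "\<And>t. t \<in> A \<Longrightarrow> \<sigma> (e0 + t *\<^sub>R u) [^] k \<in> U"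
    using pow_curve[OF open_U one_U, of u k] unfolding eventually_nhds by auto
  show ?case
    by (rule has_derivative_transform_within_open[OF D A(1,2)]) (simp add: mu_def sigma_phi A(3))
qed

end

section \<open>Products of commutators\<close>

text \<open>\<open>I\<close> is a basis of the span taken from \<open>S\<close> itself and is
  extended to a basis of the whole space; the \<open>c i\<close> are coordinates, and
  \<open>L\<close> projects onto the added basis vectors. Membership in \<open>S\<close> lets a
  single commutator realize each basis vector, and the bound on \<open>card I\<close> becomes the
  bound on the number of factors.\<close>

lemma adapted_projection:
  fixes S :: "'e::euclidean_space set"
  obtains I :: "'e set" and c :: "'e \<Rightarrow> 'e \<Rightarrow> real" and L :: "'e \<Rightarrow> 'e"
  where "I \<subseteq> S" "finite I" "card I \<le> DIM('e)" "\<And>i. linear (c i)" "linear L"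
    "\<And>x. x \<in> span S \<Longrightarrow> L x = 0" "\<And>x. L (L x) = L x" "\<And>x. (\<Sum>i\<in>I. c i x *\<^sub>R i) + L x = x"
proof -
  obtain I where I: "I \<subseteq> S" "independent I" "S \<subseteq> span I"
    by (rule maximal_independent_subset)
  obtain B where B: "I \<subseteq> B" "independent B" "(UNIV :: 'e set) \<subseteq> span B"
    using maximal_independent_subset_extend[OF subset_UNIV I(2)] by metis
  have fin: "finite I" "card I \<le> DIM('e)" using independent_bound[OF I(2)] by simp_all
  obtain L :: "'e \<Rightarrow> 'e" where L: "linear L" "\<forall>b\<in>B. L b = (if b \<in> I then 0 else b)"
    using linear_independent_extend[OF B(2), of "\<lambda>b. if b \<in> I then 0 else b"] by blast
  have "\<forall>i. \<exists>g :: 'e \<Rightarrow> real. linear g \<and> (\<forall>b\<in>B. g b = (if b = i then 1 else 0))"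
    by (intro allI linear_independent_extend[OF B(2)])
  from choice[OF this] obtain c :: "'e \<Rightarrow> 'e \<Rightarrow> real"
    where c: "\<And>i. linear (c i)" "\<And>i b. b \<in> B \<Longrightarrow> c i b = (if b = i then 1 else 0)" by blast
  show thesis
  proof (rule that[OF I(1) fin c(1) L(1)])
    fix x
    have xB: "x \<in> span B" using B(3) by blast
    have "linear (\<lambda>x. L (L x))" using linear_compose[OF L(1) L(1)] by (simp add: o_def)
    then show "L (L x) = L x"
      by (rule linear_eq_on_span[OF _ L(1) _ xB]) (simp add: L linear_0[OF L(1)])
    have "linear (\<lambda>x. (\<Sum>i\<in>I. c i x *\<^sub>R i) + L x)"
    proof (intro linear_compose_add linear_compose_sum L(1) ballI)
      fix i
      show "linear (\<lambda>x. c i x *\<^sub>R i)"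
        by (rule linearI) (simp_all add: linear_add[OF c(1)] linear_scale[OF c(1)] scaleR_add_left)
    qed
    then show "(\<Sum>i\<in>I. c i x *\<^sub>R i) + L x = x"
    proof (rule linear_eq_on_span[OF _ linear_ident _ xB])
      fix b assume b: "b \<in> B"
      have "(\<Sum>i\<in>I. c i b *\<^sub>R i) = (\<Sum>i\<in>I. if i = b then b else 0)"
        by (rule sum.cong) (simp_all add: c(2)[OF b])
      also have "\<dots> = (if b \<in> I then b else 0)" using fin(1) by (simp add: sum.delta)
      finally show "(\<Sum>i\<in>I. c i b *\<^sub>R i) + L b = b" using L(2) b by simp
    qed
  next
    fix x assume "x \<in> span S"
    then have "x \<in> span I" using I(3) span_mono[OF I(3)] span_span by blast
    then show "L x = 0"
      by (rule linear_eq_0_on_span[OF L(1), rotated]) (use L(2) B(1) in auto)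
  qed
qed

text \<open>A product of commutators is spelled as a word with four letters per commutator, the form
  to which additivity on short words applies.\<close>

lemma (in group) lprod_comm:
  assumes "\<And>i. i \<in> set is \<Longrightarrow> a i \<in> carrier G" "\<And>i. i \<in> set is \<Longrightarrow> b i \<in> carrier G"
  shows "lprod (concat (map (\<lambda>i. [a i, b i, inv (a i), inv (b i)]) is)) = lprod (map (\<lambda>i. comm (a i) (b i)) is)"
  using assms
proof (induction "is")
  case (Cons i "is")
  have "set (map (\<lambda>i. comm (a i) (b i)) is) \<subseteq> carrier G"
    using Cons.prems by (auto simp: comm_closed)
  from lprod_closed[OF this] Cons show ?case
    by (simp add: comm_def m_assoc)
qed simp

lemma (in top_group) continuous_lprod:
  "(\<And>i. i \<in> set is \<Longrightarrow> continuous_map Z T (F i)) \<Longrightarrow>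
    continuous_map Z T (\<lambda>y. lprod (map (\<lambda>i. F i y) is))"
  by (induction "is") (simp_all add: continuous_mult one_in_topspace)

context lie_chart begin

lemma bracket_scaleR_left: "bracket (r *\<^sub>R u) v = r *\<^sub>R bracket u v"
proof -
  have z: "(e0, e0) \<in> DM" by (simp add: e0_DM e0)
  have "M.D2 (e0, e0) (r *\<^sub>R u, 0) (0, v) = r *\<^sub>R M.D2 (e0, e0) (u, 0) (0, v)"
    using linear_scale[OF M.linear_D2_left[OF z, of "(0, v)"], of r "(u, 0)"] by simp
  moreover have "M.D2 (e0, e0) (v, 0) (0, r *\<^sub>R u) = r *\<^sub>R M.D2 (e0, e0) (v, 0) (0, u)"
    using linear_scale[OF M.linear_D2_right[OF z, of "(v, 0)"], of r "(0, u)"] by simp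
  ultimately show ?thesis by (simp only: bracket_def scaleR_diff_right)
qed

text \<open>Along the powers of \<open>\<sigma> (e0 + t *\<^sub>R u)\<close> some fixed exponent \<open>k\<close> returns to \<open>P\<close> for
  arbitrarily small \<open>t\<close>, and the rescaled commutator derivatives there tend to \<open>k *\<^sub>R bracket u v\<close>.\<close>

lemma bracket_mem_subspace:
  assumes V: "subspace V" and VA: "\<And>p v. p \<in> DI \<Longrightarrow> \<sigma> p \<in> P \<Longrightarrow> comm_deriv p v \<in> V"
    and W: "openin T W" "\<one> \<in> W" and PW: "P \<subseteq> {g \<in> U. \<phi> g \<in> DI}"
    and ret: "\<And>g. g \<in> carrier G \<Longrightarrow> (\<And>k. k \<le> M \<Longrightarrow> g [^] k \<in> W) \<Longrightarrow> \<exists>k\<in>{1..M::nat}. g [^] k \<in> P"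
  shows "bracket u v \<in> V"
proof (rule ccontr)
  assume bracket: "bracket u v \<notin> V"
  define c where "c k t = \<phi> (\<sigma> (e0 + t *\<^sub>R u) [^] k)" for k :: nat and t :: real
  have "\<forall>\<^sub>F t in nhds 0. \<forall>k\<in>{..M}. \<sigma> (e0 + t *\<^sub>R u) [^] k \<in> W"
    by (intro eventually_ball_finite ballI pow_curve W) simp
  moreover have "\<forall>\<^sub>F t :: real in nhds 0. e0 + t *\<^sub>R u \<in> X"
  proof -
    have "open {t :: real. e0 + t *\<^sub>R u \<in> X}"
      using open_vimage[OF open_X, of "\<lambda>t :: real. e0 + t *\<^sub>R u"]
      by (simp add: vimage_def continuous_intros)
    then show ?thesis unfolding eventually_nhds
      by (intro exI[of _ "{t :: real. e0 + t *\<^sub>R u \<in> X}"]) (simp add: e0)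
  qed
  ultimately have "\<forall>\<^sub>F t in nhds 0. \<exists>k\<in>{1..M}. \<sigma> (e0 + t *\<^sub>R u) [^] k \<in> P"
  proof eventually_elim
    case (elim t)
    show ?case
      by (rule ret) (use elim in \<open>simp_all add: sigma_carrier\<close>)
  qed
  then have A: "\<forall>\<^sub>F t in at 0. \<exists>k\<in>{1..M}. \<sigma> (e0 + t *\<^sub>R u) [^] k \<in> P"
    unfolding eventually_at_filter by (rule eventually_mono) simp
  \<comment> \<open>No recurring exponent has to be extracted: the complement of the subspace is
    open, so for small \<open>t\<close> all of the finitely many exponents are excluded at once,
    against \<open>A\<close>.\<close>
  have B: "\<forall>\<^sub>F t in at 0. \<forall>k\<in>{1..M}. comm_deriv (c k t) v /\<^sub>R t \<notin> V"
  proof (intro eventually_ball_finite ballI)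
    fix k assume k: "k \<in> {1..M}"
    have "c k 0 = e0" by (simp add: c_def e0) (simp add: e0_def)
    moreover have "(c k has_derivative (\<lambda>t. t *\<^sub>R (real k *\<^sub>R u))) (at 0)"
      unfolding c_def by (rule pow_curve_derivative)
    ultimately have lim: "((\<lambda>t. comm_deriv (c k t) v /\<^sub>R t) \<longlongrightarrow> real k *\<^sub>R bracket u v) (at 0)"
      using comm_deriv_tendsto[of "c k" "real k *\<^sub>R u" v] by (simp only: bracket_scaleR_left)
    \<comment> \<open>Here the exponents must start at \<open>1\<close>: for \<open>k = 0\<close>
      the limit would be zero and would lie in the subspace.\<close>
    have "real k *\<^sub>R bracket u v \<in> - V"
    proof
      assume "real k *\<^sub>R bracket u v \<in> V"
      from subspace_scale[OF V this, of "inverse (real k)"] show False using bracket k by simp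
    qed
    moreover have "open (- V)" using closed_subspace[OF V] by (rule open_Compl)
    ultimately have "\<forall>\<^sub>F t in at 0. comm_deriv (c k t) v /\<^sub>R t \<in> - V"
      using topological_tendstoD[OF lim] by blast
    then show "\<forall>\<^sub>F t in at 0. comm_deriv (c k t) v /\<^sub>R t \<notin> V" by simp
  qed simp
  have "\<exists>t. (\<exists>k\<in>{1..M}. \<sigma> (e0 + t *\<^sub>R u) [^] k \<in> P) \<and> (\<forall>k\<in>{1..M}. comm_deriv (c k t) v /\<^sub>R t \<notin> V)"
    by (rule eventually_happens'[OF _ eventually_conj[OF A B]]) simp
  then obtain t k where t: "\<sigma> (e0 + t *\<^sub>R u) [^] k \<in> P" "comm_deriv (c k t) v /\<^sub>R t \<notin> V" by blast
  have "c k t \<in> DI" "\<sigma> (c k t) \<in> P"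
    using t(1) PW by (auto simp: c_def sigma_phi)
  then show False using t(2) VA subspace_scale[OF V] by blast
qed

section \<open>Maps into the group that are differentiable at the origin\<close>

text \<open>Only the derivative at the origin is recorded; it adds up under products and is all that
  the open mapping argument asks for. Values near the origin are kept in \<open>U\<close>, where
  \<phi> is a coordinate.\<close>

definition plot :: "('e \<Rightarrow> 'a) \<Rightarrow> ('e \<Rightarrow> 'e) \<Rightarrow> bool" where
  "plot F A \<longleftrightarrow> F 0 = \<one> \<and> (\<forall>\<^sub>F y in nhds 0. F y \<in> U) \<and> ((\<lambda>y. \<phi> (F y)) has_derivative A) (at 0)"

lemma plot_one: "plot (\<lambda>_. \<one>) (\<lambda>_. 0)"
  by (simp add: plot_def one_U)

lemma plot_mult:
  assumes F: "plot F A" and F': "plot F' A'"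
  shows "plot (\<lambda>y. F y \<otimes> F' y) (\<lambda>y. A y + A' y)"
proof -
  let ?p = "\<lambda>y. (\<phi> (F y), \<phi> (F' y))"
  have d: "(?p has_derivative (\<lambda>y. (A y, A' y))) (at 0)"
    using F F' by (intro has_derivative_Pair) (simp_all add: plot_def)
  have p0: "?p 0 = (e0, e0)" using F F' by (simp add: plot_def e0_def)
  have z: "(e0, e0) \<in> DM" by (simp add: e0_DM e0)
  have "?p 0 \<in> DM" by (simp only: p0 z)
  then have "\<exists>B. open B \<and> 0 \<in> B \<and> (\<forall>y\<in>B. ?p y \<in> DM)"
    using has_derivative_continuous[OF d, unfolded continuous_at_open, rule_format, OF conjI[OF open_DM]]
    by simp
  then have ev: "\<forall>\<^sub>F y in nhds 0. ?p y \<in> DM"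
    unfolding eventually_nhds .
  have evU: "\<forall>\<^sub>F y in nhds 0. F y \<in> U \<and> F' y \<in> U \<and> ?p y \<in> DM"
    using F F' ev unfolding plot_def by (intro eventually_conj) simp_all
  obtain B where B: "open B" "0 \<in> B" "\<And>y. y \<in> B \<Longrightarrow> F y \<in> U \<and> F' y \<in> U \<and> ?p y \<in> DM"
    using evU unfolding eventually_nhds by blast
  have "((\<lambda>y. mu (?p y)) has_derivative (\<lambda>y. M.D1 (?p 0) (A y, A' y))) (at 0)"
    by (rule M.has_derivative_compose_D1[OF _ d]) (simp only: p0 z)
  then have D: "((\<lambda>y. mu (?p y)) has_derivative (\<lambda>y. A y + A' y)) (at 0)"
    by (simp only: p0 D1_e0)
  have "((\<lambda>y. \<phi> (F y \<otimes> F' y)) has_derivative (\<lambda>y. A y + A' y)) (at 0)"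
    by (rule has_derivative_transform_within_open[OF D B(1,2)]) (simp add: mu_def sigma_phi B(3))
  moreover have "\<forall>\<^sub>F y in nhds 0. F y \<otimes> F' y \<in> U"
    using evU by eventually_elim (auto simp: DM_def sigma_phi)
  ultimately show ?thesis using F F' by (simp add: plot_def)
qed

lemma plot_lprod:
  "(\<And>i. i \<in> set is \<Longrightarrow> plot (F i) (A i)) \<Longrightarrow>
    plot (\<lambda>y. lprod (map (\<lambda>i. F i y) is)) (\<lambda>y. \<Sum>i\<leftarrow>is. A i y)"
proof (induction "is")
  case Nil
  show ?case by (simp add: plot_one)
next
  case (Cons i "is")
  then have "plot (\<lambda>y. F i y \<otimes> lprod (map (\<lambda>i. F i y) is)) (\<lambda>y. A i y + (\<Sum>i\<leftarrow>is. A i y))"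
    by (intro plot_mult) simp_all
  then show ?case by simp
qed

lemma linear_path:
  assumes "linear (l :: 'e \<Rightarrow> 'e)"
  shows "open {y. e0 + l y \<in> X}" "0 \<in> {y. e0 + l y \<in> X}"
    "continuous_map (top_of_set {y. e0 + l y \<in> X}) T (\<lambda>y. \<sigma> (e0 + l y))"
    "((\<lambda>y. e0 + l y) has_derivative l) (at 0)"
proof -
  have bl: "bounded_linear l" using assms by (simp add: linear_conv_bounded_linear)
  have cont: "continuous_on A (\<lambda>y. e0 + l y)" for A
    by (intro continuous_intros bounded_linear.continuous_on[OF bl])
  show "open {y. e0 + l y \<in> X}"
    using open_vimage[OF open_X cont] by (simp add: vimage_def)
  show "0 \<in> {y. e0 + l y \<in> X}" by (simp add: linear_0[OF assms] e0)
  have "continuous_map (top_of_set {y. e0 + l y \<in> X}) (top_of_set X) (\<lambda>y. e0 + l y)"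
    using cont by (auto simp: continuous_map_in_subtopology)
  from continuous_map_compose[OF this continuous_sigma]
  show "continuous_map (top_of_set {y. e0 + l y \<in> X}) T (\<lambda>y. \<sigma> (e0 + l y))" by (simp add: o_def)
  show "((\<lambda>y. e0 + l y) has_derivative l) (at 0)"
    using bounded_linear_imp_has_derivative[OF bl] by (auto intro!: derivative_eq_intros)
qed

lemma linear_path_eventually:
  assumes "linear (l :: 'e \<Rightarrow> 'e)" "openin T W" "\<one> \<in> W"
  shows "\<forall>\<^sub>F y in nhds 0. \<sigma> (e0 + l y) \<in> W"
proof -
  have "open {y \<in> {y. e0 + l y \<in> X}. \<sigma> (e0 + l y) \<in> W}"
    by (rule open_continuous_vimage[OF linear_path(3,1)[OF assms(1)] assms(2)])
  moreover have "0 \<in> {y \<in> {y. e0 + l y \<in> X}. \<sigma> (e0 + l y) \<in> W}"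
    using linear_path(2)[OF assms(1)] assms(3) by (simp add: linear_0[OF assms(1)] e0)
  ultimately show ?thesis unfolding eventually_nhds by blast
qed

lemma plot_linear:
  assumes l: "linear (l :: 'e \<Rightarrow> 'e)"
  shows "plot (\<lambda>y. \<sigma> (e0 + l y)) l"
proof -
  have "((\<lambda>y. \<phi> (\<sigma> (e0 + l y))) has_derivative l) (at 0)"
    by (rule has_derivative_transform_within_open[OF linear_path(4,1,2)[OF l]]) (simp add: phi_sigma)
  then show ?thesis
    using linear_path_eventually[OF l open_U one_U] by (simp add: plot_def linear_0[OF l] e0)
qed

lemma plot_comm:
  assumes l: "linear (l :: 'e \<Rightarrow> 'e)" and p: "p \<in> DI"
  shows "plot (\<lambda>y. comm (\<sigma> p) (\<sigma> (e0 + l y))) (\<lambda>y. comm_deriv p (l y))"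
proof -
  have pG: "\<sigma> p \<in> carrier G" by (simp add: p DI_X sigma_carrier)
  have "continuous_map (top_of_set {y. e0 + l y \<in> X}) T (\<lambda>y. comm (\<sigma> p) (\<sigma> (e0 + l y)))"
    by (intro continuous_comm linear_path(3) l) (simp add: topspace_eq pG)
  from open_continuous_vimage[OF this linear_path(1)[OF l] open_U]
  have "open {y \<in> {y. e0 + l y \<in> X}. comm (\<sigma> p) (\<sigma> (e0 + l y)) \<in> U}" .
  moreover have 1: "comm (\<sigma> p) (\<sigma> (e0 + l 0)) = \<one>"
    using pG by (simp add: linear_0[OF l] e0 comm_def)
  ultimately have "\<forall>\<^sub>F y in nhds 0. comm (\<sigma> p) (\<sigma> (e0 + l y)) \<in> U"
    unfolding eventually_nhds
    by (intro exI[of _ "{y \<in> {y. e0 + l y \<in> X}. comm (\<sigma> p) (\<sigma> (e0 + l y)) \<in> U}"])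
      (use linear_path(2)[OF l] one_U in simp)
  moreover have "((\<lambda>y. \<phi> (comm (\<sigma> p) (\<sigma> (e0 + l y)))) has_derivative (\<lambda>y. comm_deriv p (l y))) (at 0)"
    by (rule has_derivative_compose[OF linear_path(4)[OF l]])
      (simp add: linear_0[OF l] has_derivative_comm p)
  ultimately show ?thesis using 1 by (simp add: plot_def)
qed

text \<open>The induction peels off one letter at a time, so every tail of the word must have its
  product in \<open>N0\<close>. For this reason the assumption speaks of all words in
  \<open>N\<close> up to the length \<open>K\<close>.\<close>

lemma additive_lprod:
  fixes f :: "'e \<Rightarrow> 'b::comm_monoid_add"
  assumes f0: "f e0 = 0"
    and f: "\<And>g h. g \<in> N0 \<Longrightarrow> h \<in> N0 \<Longrightarrow> f (\<phi> (g \<otimes> h)) = f (\<phi> g) + f (\<phi> h)"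
    and N: "N \<subseteq> N0" "\<And>gs. length gs \<le> K \<Longrightarrow> set gs \<subseteq> N \<Longrightarrow> lprod gs \<in> N0"
  shows "length gs \<le> K \<Longrightarrow> set gs \<subseteq> N \<Longrightarrow> f (\<phi> (lprod gs)) = (\<Sum>g\<leftarrow>gs. f (\<phi> g))"
proof (induction gs)
  case Nil
  show ?case by (simp add: f0 e0_def[symmetric])
next
  case (Cons g gs)
  then have "g \<in> N0" "lprod gs \<in> N0" using N by auto
  then show ?case using Cons by (simp add: f)
qed

theorem controlled_commutators: "controlled_commutators DIM('e)"
  unfolding controlled_commutators_def
proof (intro allI impI)
  fix U0 P and M :: nat
  assume U0: "openin T U0" "\<one> \<in> U0" and P: "P \<subseteq> U0"
    and ret: "\<forall>g\<in>carrier G. (\<forall>k\<le>M. g [^] k \<in> U0) \<longrightarrow> (\<exists>k\<in>{1..M}. g [^] k \<in> P)"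
  \<comment> \<open>The product of the basis commutators is a word of at most
    \<open>4 * DIM('e)\<close> letters, and a single commutator one of \<open>4\<close>. The sum
    bounds both.\<close>
  define K where "K = 4 * DIM('e) + 4"
  obtain N0 where N0: "openin T N0" "\<one> \<in> N0" "N0 \<subseteq> U" and hom:
    "\<forall>L. linear L \<longrightarrow> (\<forall>u v. L (bracket u v) = 0) \<longrightarrow>
      (\<exists>f :: 'e \<Rightarrow> 'e. f e0 = 0 \<and> (f has_derivative L) (at e0) \<and>
        (\<forall>g\<in>N0. \<forall>h\<in>N0. g \<otimes> h \<in> U \<and> f (\<phi> (g \<otimes> h)) = f (\<phi> g) + f (\<phi> h)))"
    by (rule local_homomorphism)
  obtain N1 where N1: "openin T N1" "\<one> \<in> N1" "N1 \<subseteq> N0"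
    "\<And>gs. length gs \<le> K \<Longrightarrow> set gs \<subseteq> N1 \<Longrightarrow> lprod gs \<in> N0"
    by (rule nbhd_lprod[OF N0(1,2), of K]) (rule that)
  obtain N where N: "openin T N" "\<one> \<in> N" "N \<subseteq> N1" "\<And>g. g \<in> N \<Longrightarrow> inv g \<in> N"
    by (rule nbhd_symmetric[OF N1(1,2)]) (rule that)
  have NN0: "N \<subseteq> N0" using N(3) N1(3) by (rule subset_trans)
  have Nprod: "lprod gs \<in> N0" if "length gs \<le> K" "set gs \<subseteq> N" for gs
    by (rule N1(4)[OF that(1) subset_trans[OF that(2) N(3)]])
  have NG: "g \<in> carrier G" if "g \<in> N" for g
    using openin_carrier[OF N(1) that] .
  \<comment> \<open>\<open>U0\<close> is where the second entries of the commutators must lie, words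
    in \<open>N\<close> are short enough for the local homomorphism, and on \<open>DI\<close> the
    map \<open>comm_deriv\<close> is the derivative of a commutator.\<close>
  define W where "W = U0 \<inter> (N \<inter> {g \<in> U. \<phi> g \<in> DI})"
  have W: "openin T W" "\<one> \<in> W"
    unfolding W_def using U0 N openin_phi_vimage[OF open_DI] one_U e0_DI
    by (simp_all add: openin_Int e0_def)
  define Q where "Q = {p \<in> DI. \<sigma> p \<in> P \<inter> W}"
  define S where "S = {comm_deriv p v |p v. p \<in> Q}"
  have bracket_S: "bracket u v \<in> span S" for u v
  proof (rule bracket_mem_subspace[OF subspace_span _ W, where P = "P \<inter> W" and M = M])
    show "comm_deriv p v \<in> span S" if "p \<in> DI" "\<sigma> p \<in> P \<inter> W" for p v
      by (rule span_base) (use that in \<open>auto simp: S_def Q_def\<close>)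
    show "P \<inter> W \<subseteq> {g \<in> U. \<phi> g \<in> DI}" by (auto simp: W_def)
    \<comment> \<open>Cutting \<open>P\<close> down to \<open>W\<close> preserves returns: if all
      powers up to \<open>M\<close> lie in \<open>W\<close>, so does the one that returns to
      \<open>P\<close>.\<close>
    show "\<exists>k\<in>{1..M}. g [^] k \<in> P \<inter> W" if g: "g \<in> carrier G" "\<And>k. k \<le> M \<Longrightarrow> g [^] k \<in> W" for g
    proof -
      have "\<forall>k\<le>M. g [^] k \<in> U0" using g(2) by (simp add: W_def)
      with ret g(1) obtain k where "k \<in> {1..M}" "g [^] k \<in> P" by blast
      with g(2)[of k] show ?thesis by auto
    qed
  qed
  obtain I :: "'e set" and c L where I: "I \<subseteq> S" "finite I" "card I \<le> DIM('e)"
    and c: "\<And>i. linear (c i)" and L: "linear L" "\<And>x. x \<in> span S \<Longrightarrow> L x = 0" "\<And>x. L (L x) = L x"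
    and dec: "\<And>x. (\<Sum>i\<in>I. c i x *\<^sub>R i) + L x = x"
    by (rule adapted_projection[of S]) (rule that)
  have "\<forall>i\<in>I. \<exists>pv. fst pv \<in> Q \<and> comm_deriv (fst pv) (snd pv) = i"
    using I(1) unfolding S_def by force
  from bchoice[OF this] obtain pv where pv: "\<And>i. i \<in> I \<Longrightarrow> fst (pv i) \<in> Q \<and> comm_deriv (fst (pv i)) (snd (pv i)) = i"
    by blast
  define p where "p i = fst (pv i)" for i
  \<comment> \<open>Scaling the chosen vector by the coordinate \<open>c i\<close> makes the
    commutator of index \<open>i\<close> contribute exactly that component of
    \<open>y\<close>.\<close>
  define l where "l i y = c i y *\<^sub>R snd (pv i)" for i y
  have p: "p i \<in> DI" "\<sigma> (p i) \<in> P" "\<sigma> (p i) \<in> N" if "i \<in> I" for i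
    using pv[OF that] by (auto simp: p_def Q_def W_def)
  have l: "linear (l i)" for i
    unfolding l_def by (rule linearI) (simp_all add: linear_add[OF c] linear_scale[OF c] scaleR_add_left)
  have Afl: "comm_deriv (p i) (l i y) = c i y *\<^sub>R i" if "i \<in> I" for i y
    using pv[OF that] linear_scale[OF linear_comm_deriv[OF p(1)[OF that]]] by (simp add: p_def l_def)
  obtain f :: "'e \<Rightarrow> 'e" where f: "f e0 = 0" "(f has_derivative L) (at e0)"
    "\<And>g h. g \<in> N0 \<Longrightarrow> h \<in> N0 \<Longrightarrow> f (\<phi> (g \<otimes> h)) = f (\<phi> g) + f (\<phi> h)"
    using hom[rule_format, OF L(1) L(2)[OF bracket_S]] by blast
  have f_lprod: "f (\<phi> (lprod gs)) = (\<Sum>g\<leftarrow>gs. f (\<phi> g))" if "length gs \<le> K" "set gs \<subseteq> N" for gs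
    using f(1) f(3) NN0 Nprod that by (rule additive_lprod)
  have f_inv: "f (\<phi> (inv g)) = - f (\<phi> g)" if g: "g \<in> N" for g
  proof -
    have "f (\<phi> (lprod [g, inv g])) = (\<Sum>g\<leftarrow>[g, inv g]. f (\<phi> g))"
      by (rule f_lprod) (use g N(4) in \<open>auto simp: K_def\<close>)
    then have "f (\<phi> g) + f (\<phi> (inv g)) = 0" using NG[OF g] f(1) by (simp add: e0_def)
    then show ?thesis by (simp add: eq_neg_iff_add_eq_0 add.commute)
  qed
  obtain "is" where "is": "distinct is" "set is = I" using finite_distinct_list[OF I(2)] by blast
  have len: "length is \<le> DIM('e)" using "is" I(3) distinct_card by metis
  define x where "x i y = \<sigma> (e0 + l i y)" for i y
  define cs where "cs y = lprod (map (\<lambda>i. comm (\<sigma> (p i)) (x i y)) is)" for y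
  define F where "F y = cs y \<otimes> \<sigma> (e0 + L y)" for y
  have "plot F (\<lambda>y. (\<Sum>i\<leftarrow>is. comm_deriv (p i) (l i y)) + L y)"
    unfolding F_def cs_def x_def
    by (intro plot_mult plot_lprod plot_comm plot_linear l L(1)) (use "is" p in auto)
  also have "(\<lambda>y. (\<Sum>i\<leftarrow>is. comm_deriv (p i) (l i y)) + L y) = (\<lambda>y. y)"
  proof
    fix y
    have "(\<Sum>i\<leftarrow>is. comm_deriv (p i) (l i y)) = (\<Sum>i\<in>I. comm_deriv (p i) (l i y))"
      using sum_list_distinct_conv_sum_set[OF "is"(1)] "is"(2) by simp
    also have "\<dots> = (\<Sum>i\<in>I. c i y *\<^sub>R i)" by (rule sum.cong) (simp_all add: Afl)
    finally show "(\<Sum>i\<leftarrow>is. comm_deriv (p i) (l i y)) + L y = y" by (simp only: dec)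
  qed
  finally have plotF: "F 0 = \<one>" "((\<lambda>y. \<phi> (F y)) has_derivative (\<lambda>y. y)) (at 0)"
    by (simp_all add: plot_def)
  define J0 where "J0 = (\<Inter>i\<in>I. {y. e0 + l i y \<in> X}) \<inter> {y. e0 + L y \<in> X}"
  have J0: "open J0" "0 \<in> J0"
    unfolding J0_def using linear_path(1,2) l L(1) I(2) by (simp_all add: open_Int open_INT)
  have contF: "continuous_map (top_of_set J0) T F"
    unfolding F_def cs_def x_def
  proof (intro continuous_mult continuous_lprod continuous_comm)
    have sub: "continuous_map (top_of_set J0) T (\<lambda>y. \<sigma> (e0 + l' y))"
      if "linear l'" "J0 \<subseteq> {y. e0 + l' y \<in> X}" for l'
      using continuous_map_from_subtopology_mono[OF linear_path(3)[OF that(1)] that(2)] .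
    show "continuous_map (top_of_set J0) T (\<lambda>y. \<sigma> (e0 + L y))"
      by (rule sub[OF L(1)]) (simp add: J0_def)
    fix i assume "i \<in> set is"
    then have i: "i \<in> I" using "is" by simp
    show "continuous_map (top_of_set J0) T (\<lambda>y. \<sigma> (p i))"
      using NG[OF p(3)[OF i]] by (simp add: topspace_eq)
    show "continuous_map (top_of_set J0) T (\<lambda>y. \<sigma> (e0 + l i y))"
      by (rule sub[OF l]) (use i in \<open>auto simp: J0_def\<close>)
  qed
  define J where "J = {y \<in> J0. F y \<in> U}"
  have J: "open J" "0 \<in> J"
    unfolding J_def using open_continuous_vimage[OF contF J0(1) open_U] J0(2) plotF(1) one_U by simp_all
  have contJ: "continuous_on J (\<lambda>y. \<phi> (F y))"
  proof -
    have "continuous_map (top_of_set J) (subtopology T U) F"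
      using continuous_map_from_subtopology_mono[OF contF, of J]
      by (auto simp: continuous_map_in_subtopology J_def)
    from continuous_map_compose[OF this continuous_phi] show ?thesis by (simp add: o_def)
  qed
  \<comment> \<open>The factor only has to be below \<open>1\<close>: on vectors fixed by
    \<open>L\<close>, \<open>f\<close> then differs from the identity by at most half the norm, so
    it vanishes at none of them except zero.\<close>
  obtain d where d: "d > 0" "\<And>z. norm (z - e0) < d \<Longrightarrow> norm (f z - f e0 - L (z - e0)) \<le> 1/2 * norm (z - e0)"
    using f(2)[unfolded has_derivative_at_alt, THEN conjunct2, rule_format, of "1/2"] by auto
  have rigid: "y = 0" if "L y = y" "norm y < d" "f (e0 + y) = 0" for y
    using d(2)[of "e0 + y"] that f(1) by simp
  \<comment> \<open>The bound \<open>d\<close> is imposed on \<open>L y\<close>, since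
    \<open>rigid\<close> will be applied to \<open>L y\<close> rather than to
    \<open>y\<close>.\<close>
  define D where "D = {y \<in> J. (\<forall>i\<in>I. x i y \<in> W) \<and> \<sigma> (e0 + L y) \<in> W \<and> norm (L y) < d}"
  have "\<forall>\<^sub>F y in nhds 0. y \<in> D"
  proof -
    have "\<forall>\<^sub>F y in nhds 0. y \<in> J" using J by (auto simp: eventually_nhds)
    moreover have "\<forall>\<^sub>F y in nhds 0. \<forall>i\<in>I. x i y \<in> W"
      unfolding x_def by (intro eventually_ball_finite I(2) ballI linear_path_eventually l W)
    moreover have "\<forall>\<^sub>F y in nhds 0. \<sigma> (e0 + L y) \<in> W"
      by (rule linear_path_eventually[OF L(1) W])
    moreover have "\<forall>\<^sub>F y in nhds 0. norm (L y) < d"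
    proof -
      have "continuous_on UNIV (\<lambda>y. norm (L y))"
        using L(1) by (intro continuous_on_norm linear_continuous_on) (simp add: linear_conv_bounded_linear)
      from open_vimage[OF open_lessThan this, of d] show ?thesis
        unfolding eventually_nhds
        by (intro exI[of _ "(\<lambda>y. norm (L y)) -` {..<d}"]) (simp add: linear_0[OF L(1)] d(1))
    qed
    ultimately show ?thesis by eventually_elim (simp add: D_def)
  qed
  then have D0: "0 \<in> interior D"
    unfolding eventually_nhds interior_def by blast
  have "D \<subseteq> J" by (auto simp: D_def)
  \<comment> \<open>\<open>F\<close> is known to be differentiable only at \<open>0\<close>. A
    continuous map whose derivative at one point is onto still maps neighborhoods of that point to
    neighborhoods of its value.\<close>
  have int: "\<phi> (F 0) \<in> interior ((\<lambda>y. \<phi> (F y)) ` D)"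
    by (rule sussmann_open_mapping[OF J(1) contJ J(2) plotF(2) bounded_linear_ident _ \<open>D \<subseteq> J\<close> D0])
      (simp add: fun_eq_iff)
  let ?V = "{g \<in> U. \<phi> g \<in> interior ((\<lambda>y. \<phi> (F y)) ` D)}"
  have V: "openin T ?V" by (rule openin_phi_vimage[OF open_interior])
  have "comm \<one> \<one> \<in> ?V" using int one_U plotF(1) by (simp add: comm_def)
  moreover have "continuous_map (prod_topology T T) T (\<lambda>(x, y). comm x y)"
    unfolding split_def by (intro continuous_comm continuous_map_fst continuous_map_snd)
  ultimately obtain W' where W': "openin T W'" "\<one> \<in> W'" "\<And>x y. x \<in> W' \<Longrightarrow> y \<in> W' \<Longrightarrow> comm x y \<in> ?V"
    using nbhd_two_variables[of comm ?V] V by metis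
  have main: "\<exists>ps. length ps \<le> DIM('e) \<and> set ps \<subseteq> P \<times> U0 \<and> comm g h = lprod (map (\<lambda>(p, x). comm p x) ps)"
    if gh: "g \<in> W' \<inter> N" "h \<in> W' \<inter> N" for g h
  proof -
    have ghV: "comm g h \<in> ?V" using W'(3) gh by blast
    then obtain y where y: "y \<in> D" "\<phi> (comm g h) = \<phi> (F y)"
      using interior_subset by auto
    have yU: "F y \<in> U" and xW: "\<And>i. i \<in> I \<Longrightarrow> x i y \<in> W" and LW: "\<sigma> (e0 + L y) \<in> W"
      and yJ: "y \<in> J0" and yd: "norm (L y) < d"
      using y(1) by (auto simp: D_def J_def)
    have eq: "comm g h = F y"
      using sigma_phi[OF yU] sigma_phi[of "comm g h"] ghV y(2) by simp
    \<comment> \<open>The values of \<open>f\<close> add commutatively, so the four letters of a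
      commutator cancel in pairs.\<close>
    have fcomm: "f (\<phi> (comm g h)) = 0"
    proof -
      have "comm g h = lprod [g, h, inv g, inv h]"
        using gh NG by (simp add: comm_def m_assoc)
      moreover have "f (\<phi> (lprod [g, h, inv g, inv h])) = (\<Sum>g\<leftarrow>[g, h, inv g, inv h]. f (\<phi> g))"
        by (rule f_lprod) (use gh N(4) in \<open>auto simp: K_def\<close>)
      ultimately show ?thesis using gh by (simp add: f_inv)
    qed
    have xN: "x i y \<in> N" if "i \<in> I" for i using xW[OF that] by (simp add: W_def)
    let ?gs = "concat (map (\<lambda>i. [\<sigma> (p i), x i y, inv (\<sigma> (p i)), inv (x i y)]) is)"
    have cs: "cs y = lprod ?gs"
      unfolding cs_def by (rule lprod_comm[symmetric]) (use "is" p xN NG in auto)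
    have gsN: "set ?gs \<subseteq> N" using "is" p xN N(4) by auto
    have "length ?gs = 4 * length is" by (induction "is") simp_all
    then have gsK: "length ?gs \<le> K" using len by (simp add: K_def)
    have "f (\<phi> (cs y)) = (\<Sum>g\<leftarrow>?gs. f (\<phi> g))" unfolding cs by (rule f_lprod[OF gsK gsN])
    also have "\<dots> = (\<Sum>i\<leftarrow>is. 0)"
    proof -
      have "(\<Sum>g\<leftarrow>concat (map (\<lambda>i. [\<sigma> (p i), x i y, inv (\<sigma> (p i)), inv (x i y)]) js). f (\<phi> g)) = (\<Sum>i\<leftarrow>js. 0)"
        if "set js \<subseteq> I" for js
        using that by (induction js) (simp_all add: f_inv p xN)
      then show ?thesis using "is" by simp
    qed
    finally have fcs: "f (\<phi> (cs y)) = 0" by simp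
    have csN: "cs y \<in> N0" unfolding cs by (rule Nprod[OF gsK gsN])
    have LN: "\<sigma> (e0 + L y) \<in> N0" using LW NN0 by (auto simp: W_def)
    have LX: "e0 + L y \<in> X" using yJ by (simp add: J0_def)
    have "f (\<phi> (F y)) = f (e0 + L y)"
      unfolding F_def using f(3)[OF csN LN] fcs by (simp add: phi_sigma[OF LX])
    then have "f (e0 + L y) = 0" using fcomm eq by simp
    \<comment> \<open>\<open>L y\<close> is fixed by \<open>L\<close> because \<open>L\<close> is a
      projection. Once it vanishes, the last factor of \<open>F y\<close> is the identity and only
      commutators remain.\<close>
    then have "L y = 0" by (rule rigid[OF L(3) yd])
    then have "comm g h = cs y \<otimes> \<one>" using eq by (simp add: F_def e0)
    also have "\<dots> = cs y" using openin_carrier[OF N0(1) csN] by simp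
    finally have "comm g h = lprod (map (\<lambda>(p, x). comm p x) (map (\<lambda>i. (\<sigma> (p i), x i y)) is))"
      by (simp add: cs_def o_def)
    moreover have "set (map (\<lambda>i. (\<sigma> (p i), x i y)) is) \<subseteq> P \<times> U0"
      using "is" p(2) xW by (auto simp: W_def)
    ultimately show ?thesis using len by (intro exI[of _ "map (\<lambda>i. (\<sigma> (p i), x i y)) is"]) simp
  qed
  show "\<exists>V. openin T V \<and> \<one> \<in> V \<and> (\<forall>g\<in>V. \<forall>h\<in>V. \<exists>ps. length ps \<le> DIM('e) \<and> set ps \<subseteq> P \<times> U0 \<and>
      comm g h = lprod (map (\<lambda>(p, x). comm p x) ps))"
    by (rule exI[of _ "W' \<inter> N"]) (use W' N main in \<open>simp add: openin_Int\<close>)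
qed

end

section \<open>The discontinuity group\<close>

text \<open>The maps provided by an atlas agree with \<open>mu\<close> and \<open>iota\<close> only
  on their domains. On an open set this is enough, since derivatives are local.\<close>

lemma Ck_on_cong:
  assumes "open S" "\<And>x. x \<in> S \<Longrightarrow> f x = g x" "Ck_on k f S"
  shows "Ck_on k g S"
  using assms(2,3)
proof (induction k arbitrary: f g)
  case 0
  then show ?case using continuous_on_cong[of S S f g] by simp
next
  case (Suc k)
  have "g differentiable (at x)" if "x \<in> S" for x
  proof -
    have "f differentiable (at x)" using Suc.prems(2) that by simp
    then obtain f' where "(f has_derivative f') (at x)" unfolding differentiable_def by blast
    from has_derivative_transform_within_open[OF this assms(1) that Suc.prems(1)]
    show ?thesis by (auto simp: differentiable_def)
  qed
  moreover have "Ck_on k (\<lambda>x. frechet_derivative g (at x) v) S" for v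
  proof (rule Suc.IH)
    show "frechet_derivative f (at x) v = frechet_derivative g (at x) v" if "x \<in> S" for x
      using frechet_derivative_transform_within_open[OF _ assms(1) that Suc.prems(1)] Suc.prems(2) that
      by simp
  qed (use Suc.prems(2) in simp)
  ultimately show ?case by simp
qed

lemma lie_group_top_group:
  assumes "lie_group TYPE('e::euclidean_space) G T"
  shows "top_group G T"
proof -
  interpret group G using assms by (simp add: lie_group_def)
  have T: "topspace T = carrier G" using assms by (simp add: lie_group_def)
  have "continuous_map (prod_topology T T) T (\<lambda>(x, y). x \<otimes>\<^bsub>G\<^esub> y) \<and> continuous_map T T (\<lambda>x. inv\<^bsub>G\<^esub> x)"
  proof (cases "T = discrete_topology (carrier G)")
    case True
    then show ?thesis by (auto simp: prod_topology_discrete_topology[symmetric])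
  next
    case False
    then show ?thesis using assms by (auto simp: lie_group_def smooth_map_def)
  qed
  with T show ?thesis by unfold_locales simp_all
qed

lemma lie_group_controlled_commutators:
  assumes "lie_group TYPE('e::euclidean_space) G T"
  shows "top_group.controlled_commutators G T DIM('e)"
proof -
  interpret top_group G T by (rule lie_group_top_group[OF assms])
  show ?thesis
  proof (cases "T = discrete_topology (carrier G)")
    case True
    \<comment> \<open>In a discrete group the identity alone is a neighborhood, and its only
      commutator is the empty product.\<close>
    then have "openin T {\<one>\<^bsub>G\<^esub>}" by simp
    moreover have "comm \<one>\<^bsub>G\<^esub> \<one>\<^bsub>G\<^esub> = \<one>\<^bsub>G\<^esub>" by (simp add: comm_def)
    ultimately show ?thesis
      unfolding controlled_commutators_def
      by (intro allI impI exI[of _ "{\<one>\<^bsub>G\<^esub>}"]) (auto intro!: exI[of _ "[]"])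
  next
    case False
    with assms obtain A :: "('a, 'e) chart set" where A: "smooth_atlas T A"
      "smooth_map (prod_topology T T) (prod_atlas A A) T A (\<lambda>(x, y). x \<otimes>\<^bsub>G\<^esub> y)"
      "smooth_map T A T A (\<lambda>x. inv\<^bsub>G\<^esub> x)"
      unfolding lie_group_def by blast
    have "\<one>\<^bsub>G\<^esub> \<in> (\<Union>(U, \<phi>)\<in>A. U)"
      using A(1) one_in_topspace by (simp add: smooth_atlas_def)
    then obtain U \<phi> where U: "(U, \<phi>) \<in> A" "\<one>\<^bsub>G\<^esub> \<in> U" by blast
    define X where "X = \<phi> ` U"
    define \<sigma> where "\<sigma> = inv_into U \<phi>"
    have "is_chart T (U, \<phi>)" using A(1) U(1) by (simp add: smooth_atlas_def)
    then have ch: "openin T U" "open X" "homeomorphic_map (subtopology T U) (top_of_set X) \<phi>"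
      by (simp_all add: is_chart_def X_def)
    have topU: "topspace (subtopology T U) = U" using openin_subset[OF ch(1)] by auto
    obtain \<psi> where \<psi>: "homeomorphic_maps (subtopology T U) (top_of_set X) \<phi> \<psi>"
      using ch(3) by (auto simp: homeomorphic_map_maps)
    then have hm: "continuous_map (subtopology T U) (top_of_set X) \<phi>"
      "continuous_map (top_of_set X) (subtopology T U) \<psi>" "\<And>g. g \<in> U \<Longrightarrow> \<psi> (\<phi> g) = g"
      using topU by (simp_all add: homeomorphic_maps_def)
    have inj: "inj_on \<phi> U" using hm(3) by (rule inj_on_inverseI)
    have s: "\<sigma> (\<phi> g) = g" if "g \<in> U" for g
      unfolding \<sigma>_def by (rule inv_into_f_f[OF inj that])
    have eq: "\<psi> x = \<sigma> x" if "x \<in> X" for x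
      using that hm(3) s by (auto simp: X_def)
    interpret chart_group G T U \<phi> \<sigma> X
    proof
      show "continuous_map (subtopology T U) euclidean \<phi>"
        using hm(1) by (simp add: continuous_map_in_subtopology)
      have "continuous_map (top_of_set X) (subtopology T U) \<sigma>"
        by (rule continuous_map_eq[OF hm(2)]) (simp add: eq)
      then show "continuous_map (top_of_set X) T \<sigma>"
        by (simp add: continuous_map_in_subtopology)
    qed (use U ch s in \<open>auto simp: X_def\<close>)
    \<comment> \<open>\<open>inv_into\<close> is defined by choice, but injectivity of the product
      chart determines it on the image.\<close>
    have inv2: "inv_into (U \<times> U) (map_prod \<phi> \<phi>) (x, y) = (\<sigma> x, \<sigma> y)" if "x \<in> X" "y \<in> X" for x y
      by (rule inv_into_f_eq[OF map_prod_inj_on[OF inj inj]])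
        (use that in \<open>simp_all add: sigma_in phi_sigma\<close>)
    \<comment> \<open>\<open>DM\<close> has to be recognized as the chart image on which
      \<open>smooth_map\<close> asserts smoothness of the product.\<close>
    have DM: "DM = map_prod \<phi> \<phi> ` ((U \<times> U) \<inter> (\<lambda>(x, y). x \<otimes>\<^bsub>G\<^esub> y) -` U)"
    proof (intro equalityI subsetI)
      fix z assume "z \<in> DM"
      then obtain x y where z: "z = (x, y)" "x \<in> X" "y \<in> X" "\<sigma> x \<otimes>\<^bsub>G\<^esub> \<sigma> y \<in> U" by (auto simp: DM_def)
      then show "z \<in> map_prod \<phi> \<phi> ` ((U \<times> U) \<inter> (\<lambda>(x, y). x \<otimes>\<^bsub>G\<^esub> y) -` U)"
        by (intro image_eqI[of _ _ "(\<sigma> x, \<sigma> y)"]) (simp_all add: phi_sigma sigma_in)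
    next
      fix z assume "z \<in> map_prod \<phi> \<phi> ` ((U \<times> U) \<inter> (\<lambda>(x, y). x \<otimes>\<^bsub>G\<^esub> y) -` U)"
      then show "z \<in> DM" by (auto simp: DM_def s phi_in)
    qed
    have DI: "DI = \<phi> ` (U \<inter> (\<lambda>x. inv\<^bsub>G\<^esub> x) -` U)"
      unfolding DI_def by (auto simp: X_def s)
    have "(U \<times> U, map_prod \<phi> \<phi>) \<in> prod_atlas A A" using U(1) by (auto simp: prod_atlas_def)
    then have "smooth_on (\<phi> \<circ> (\<lambda>(x, y). x \<otimes>\<^bsub>G\<^esub> y) \<circ> inv_into (U \<times> U) (map_prod \<phi> \<phi>)) DM"
      using A(2) U(1) unfolding smooth_map_def DM by blast
    then have mu2: "Ck_on 2 (\<phi> \<circ> (\<lambda>(x, y). x \<otimes>\<^bsub>G\<^esub> y) \<circ> inv_into (U \<times> U) (map_prod \<phi> \<phi>)) DM"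
      by (simp add: smooth_on_def)
    have "smooth_on (\<phi> \<circ> (\<lambda>x. inv\<^bsub>G\<^esub> x) \<circ> inv_into U \<phi>) DI"
      using A(3) U(1) unfolding smooth_map_def DI by blast
    then have iota2: "Ck_on 2 (\<phi> \<circ> (\<lambda>x. inv\<^bsub>G\<^esub> x) \<circ> inv_into U \<phi>) DI"
      by (simp add: smooth_on_def)
    interpret lie_chart G T U \<phi> \<sigma> X
    proof
      show "Ck_on 2 mu DM"
        by (rule Ck_on_cong[OF open_DM _ mu2]) (auto simp: mu_def DM_def inv2)
      show "Ck_on 2 iota DI"
        by (rule Ck_on_cong[OF open_DI _ iota2]) (simp only: iota_def o_apply \<sigma>_def[symmetric])
    qed
    show ?thesis by (rule controlled_commutators)
  qed
qed

theorem theorem2: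
  fixes G :: "('g, 'r) monoid_scheme" and S :: "'g topology"
    and H :: "('h, 's) monoid_scheme" and T :: "'h topology"
    and \<pi> :: "'g \<Rightarrow> 'h"
  assumes "lie_group TYPE('m::euclidean_space) G S"
    and "lie_group TYPE('n::euclidean_space) H T"
    and "\<pi> \<in> hom G H"
    and "locally_bounded G S H T \<pi>"
  shows "comm_group (H\<lparr>carrier := DG G S T \<pi>\<rparr>)"
proof (rule DG_comm_group)
  show "Hausdorff_space T" using assms(2) by (simp add: lie_group_def)
qed (use assms lie_group_top_group lie_group_controlled_commutators in blast)+

end
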